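(* Let $k\ge 1$ be an integer and let $\Phi:\mathbb{N}\to[k,\infty)$ be a function. Let $$\mathcal F_k(\Phi)=\Big\{x\in I:\ \sum_{i=1}^k\deg A_{n+i}(x)\ge \Phi(n)\ \text{for infinitely many } n\in\mathbb{N}\Big\}.$$ Then $$\nu(\mathcal F_k(\Phi))=\begin{cases}0, & \text{if } \sum_{n=1}^\infty \dfrac{\Phi(n)^{k-1}}{q^{\Phi(n)}}<\infty,\\[2ex] 1, & \text{if } \sum_{n=1}^\infty \dfrac{\Phi(n)^{k-1}}{q^{\Phi(n)}}=\infty.\end{cases}$$
   Context: $\mathbb{F}_q$ is a finite field with $q$ elements and $\mathbb{F}_q((z^{-1}))$ is the field of formal Laurent series $x=\sum_{n=v}^\infty c_nz^{-n}$ ($v\in\mathbb Z$, $c_n\in\mathbb{F}_q$), with the non-Archimedean absolute value $|0|_\infty=0$ and $|x|_\infty=q^{-v}$ if $c_v\neq0$ is the first non-zero coefficient. The integer part of $x$ is the polynomial $[x]=\sum_{n=v}^0c_nz^{-n}\in\mathbb{F}_q[z]$. $I=\{x:|x|_\infty<1\}$, and $\nu$ is the Haar measure on the compact additive group $I$ normalised by $\nu(I)=1$. The Gauss map $T:I\to I$ is $T(x)=\frac1x-[\frac1x]$ for $x\ne0$, $T(0)=0$. The partial quotients of $x\in I$ are $A_i(x)=[1/T^{i-1}(x)]$, $i\ge1$, defined as long as $T^{i-1}(x)\neq0$; they are polynomials in $\mathbb{F}_q[z]$ of strictly positive degree. An inequality involving $\deg A_{n+1}(x),\dots,\deg A_{n+k}(x)$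 is understood to require that these partial quotients are defined (they all are when $x$ is irrational, i.e. not in $\mathbb{F}_q(z)$). *)

theory Defs
  imports
    "HOL-Computational_Algebra.Formal_Laurent_Series"
    "HOL-Probability.Probability"
begin

unbundle fps_syntax

text \<open>
  The field of formal Laurent series in $z^{-1}$ over the finite field \<open>'a\<close>, with
  $q$ = \<open>CARD('a)\<close>, is \<open>'a fls\<close>: the indeterminate \<open>fls_X\<close> stands for $z^{-1}$, so that
  \<open>x $$ n\<close> is the coefficient $c_n$ of $z^{-n}$, \<open>fls_subdegree x\<close> is $v$ for nonzero $x$, and
  \<open>fls_X_inv\<close> is $z$.  The type \<open>'a poly\<close> is the polynomial ring in $z$.
\<close>

definition laurent_abs :: "'a::{field,finite} fls \<Rightarrow> real" where
  "laurent_abs x = (if x = 0 then 0 else real CARD('a) powi (- fls_subdegree x))"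

definition unit_ideal :: "'a::{field,finite} fls set" where
  "unit_ideal = {x. laurent_abs x < 1}"

text \<open>The library function \<open>fls_prpart\<close> omits the constant term.\<close>

definition int_part :: "'a::{field,finite} fls \<Rightarrow> 'a poly" where
  "int_part x = fls_prpart x + [:x $$ 0:]"

text \<open>The inclusion of the polynomials in $z$ into the Laurent series: evaluation at $z$.\<close>

definition poly_to_laurent :: "'a::{field,finite} poly \<Rightarrow> 'a fls" where
  "poly_to_laurent p = poly (map_poly fls_const p) fls_X_inv"

definition gauss_map :: "'a::{field,finite} fls \<Rightarrow> 'a fls" where
  "gauss_map x = (if x = 0 then 0 else 1 / x - poly_to_laurent (int_part (1 / x)))"

text \<open>
  The partial quotient $A_i(x)$ for $i \ge 1$.  It is a genuine partial quotient only under
  \<open>partial_quotient_defined x i\<close>; otherwise the value is the dummy $0$, since \<open>1 / 0 = 0\<close>.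
\<close>

definition partial_quotient :: "'a::{field,finite} fls \<Rightarrow> nat \<Rightarrow> 'a poly" where
  "partial_quotient x i = int_part (1 / (gauss_map ^^ (i - 1)) x)"

definition partial_quotient_defined :: "'a::{field,finite} fls \<Rightarrow> nat \<Rightarrow> bool" where
  "partial_quotient_defined x i \<longleftrightarrow> (gauss_map ^^ (i - 1)) x \<noteq> 0"

definition F_set :: "nat \<Rightarrow> (nat \<Rightarrow> real) \<Rightarrow> 'a::{field,finite} fls set" where
  "F_set k \<Phi> = {x \<in> unit_ideal. infinite {n. n \<ge> 1 \<and>
      (\<forall>i\<in>{1..k}. partial_quotient_defined x (n + i)) \<and>
      real (\<Sum>i=1..k. degree (partial_quotient x (n + i))) \<ge> \<Phi> n}}"

text \<open>
  \<open>normalized_haar \<nu>\<close>: \<open>\<nu>\<close> is the translation-invariant Borel probability measure on the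
  additive group \<open>unit_ideal\<close>.  The topology behind \<open>borel\<close> is the library's topology on
  \<open>'a fls\<close>, whose metric uses base 2 in place of $q$; by \<open>open_iff_laurent_abs\<close> below it is the
  topology of \<open>laurent_abs\<close>.  Lemma \<open>normalized_haar_exists\<close> shows that there is such a measure.
\<close>

definition normalized_haar :: "'a::{field,finite} fls measure \<Rightarrow> bool" where
  "normalized_haar \<nu> \<longleftrightarrow>
     sets \<nu> = sets (restrict_space borel unit_ideal) \<and>
     emeasure \<nu> unit_ideal = 1 \<and>
     (\<forall>a\<in>unit_ideal. \<forall>B\<in>sets \<nu>. emeasure \<nu> ((\<lambda>x. a + x) ` B) = emeasure \<nu> B)"

lemma coeff_int_part: "coeff (int_part x) n = x $$ (- int n)"
  by (cases n) (auto simp: int_part_def)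

lemma poly_to_laurent_pCons:
  "poly_to_laurent (pCons a p) = fls_const a + fls_X_inv * poly_to_laurent p"
  by (simp add: poly_to_laurent_def map_poly_pCons)

lemma poly_to_laurent_nth:
  "poly_to_laurent p $$ n = (if n \<le> 0 then coeff p (nat (- n)) else 0)"
proof (induction p arbitrary: n)
  case 0
  show ?case by (simp add: poly_to_laurent_def)
next
  case (pCons a p)
  have "nat (- n) = Suc (nat (- (n + 1)))" if "n < 0"
    using that by simp
  thus ?case
    by (cases "n = 0")
      (auto simp: poly_to_laurent_pCons pCons.IH fls_X_inv_times_conv_shift)
qed

lemma one_less_CARD_field: "1 < real CARD('a::{field,finite})"
proof -
  have "card {0, 1::'a} \<le> CARD('a)" by (intro card_mono) auto
  thus ?thesis by simp
qed

lemma power_int_less_iff: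
  assumes "1 < (b::real)"
  shows "b powi m < b powi n \<longleftrightarrow> m < n"
  using assms power_int_strict_increasing[of m n b] power_int_increasing[of n m b]
  by (cases "m < n") auto

lemma laurent_abs_less_iff:
  "laurent_abs (x::'a::{field,finite} fls) < real CARD('a) powi (- m) \<longleftrightarrow> x = 0 \<or> m < fls_subdegree x"
  using one_less_CARD_field[where 'a='a] zero_less_power_int[of "real CARD('a)" "- m"]
  by (auto simp: laurent_abs_def power_int_less_iff)

lemma dist_fls_less_iff:
  "dist (x::'a::{field,finite} fls) y < 2 powi (- m) \<longleftrightarrow> x = y \<or> m < fls_subdegree (x - y)"
proof -
  have "dist x y = (if x = y then 0 else 2 powi (- fls_subdegree (x - y)))"
    by (auto simp: dist_fls_def power_int_def power_one_over inverse_eq_divide)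
  thus ?thesis by (auto simp: power_int_less_iff)
qed

lemma unit_ideal_iff: "x \<in> unit_ideal \<longleftrightarrow> (\<forall>n\<le>0. x $$ n = 0)"
proof -
  have "x \<in> unit_ideal \<longleftrightarrow> x = 0 \<or> 0 < fls_subdegree x"
    using laurent_abs_less_iff[of x 0] by (simp add: unit_ideal_def)
  also have "\<dots> \<longleftrightarrow> (\<forall>n\<le>0. x $$ n = 0)"
    by (metis fls_eq0_below_subdegree fls_zero_nth le_less_trans not_le nth_fls_subdegree_nonzero)
  finally show ?thesis .
qed

lemma exists_powi_less:
  assumes "1 < (b::real)" "0 < r"
  obtains m where "b powi (- int m) < r"
proof -
  obtain m where "(1 / b) ^ m < r"
    using real_arch_pow_inv[of r "1 / b"] assms by auto
  hence "b powi (- int m) < r"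
    by (simp add: power_int_minus power_one_over inverse_eq_divide)
  thus ?thesis using that by blast
qed

lemma open_fls_iff_subdegree:
  "open (S :: 'a::{field,finite} fls set) \<longleftrightarrow>
     (\<forall>x\<in>S. \<exists>m::nat. \<forall>y. y = x \<or> int m < fls_subdegree (y - x) \<longrightarrow> y \<in> S)"
  (is "_ \<longleftrightarrow> (\<forall>x\<in>S. ?P x)")
proof -
  have "(\<exists>e>0. \<forall>y. dist y x < e \<longrightarrow> y \<in> S) \<longleftrightarrow> ?P x" for x
  proof
    assume "\<exists>e>0. \<forall>y. dist y x < e \<longrightarrow> y \<in> S"
    then obtain e where e: "e > 0" "\<And>y. dist y x < e \<Longrightarrow> y \<in> S" by blast
    obtain m where "(2::real) powi (- int m) < e"
      using exists_powi_less[of 2 e] e(1) by auto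
    thus "?P x"
      using e(2) dist_fls_less_iff[of _ x "int m"] by (metis order.strict_trans)
  next
    assume "?P x"
    then obtain m where "\<forall>y. y = x \<or> int m < fls_subdegree (y - x) \<longrightarrow> y \<in> S" by blast
    thus "\<exists>e>0. \<forall>y. dist y x < e \<longrightarrow> y \<in> S"
      by (intro exI[of _ "2 powi (- int m)"]) (auto simp: dist_fls_less_iff)
  qed
  thus ?thesis by (simp add: open_dist)
qed

lemma open_iff_laurent_abs:
  "open (S :: 'a::{field,finite} fls set) \<longleftrightarrow>
     (\<forall>x\<in>S. \<exists>e>0. \<forall>y. laurent_abs (y - x) < e \<longrightarrow> y \<in> S)"
proof -
  have "(\<exists>e>0. \<forall>y. laurent_abs (y - x) < e \<longrightarrow> y \<in> S) \<longleftrightarrow>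
      (\<exists>m::nat. \<forall>y. y = x \<or> int m < fls_subdegree (y - x) \<longrightarrow> y \<in> S)" for x
  proof
    assume "\<exists>e>0. \<forall>y. laurent_abs (y - x) < e \<longrightarrow> y \<in> S"
    then obtain e where e: "e > 0" "\<And>y. laurent_abs (y - x) < e \<Longrightarrow> y \<in> S" by blast
    obtain m where "real CARD('a) powi (- int m) < e"
      using exists_powi_less[of "real CARD('a)" e] e(1) one_less_CARD_field by blast
    thus "\<exists>m::nat. \<forall>y. y = x \<or> int m < fls_subdegree (y - x) \<longrightarrow> y \<in> S"
      using e(2) laurent_abs_less_iff[of "_ - x" "int m"]
      by (metis order.strict_trans right_minus_eq)
  next
    assume "\<exists>m::nat. \<forall>y. y = x \<or> int m < fls_subdegree (y - x) \<longrightarrow> y \<in> S"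
    then obtain m where "\<forall>y. y = x \<or> int m < fls_subdegree (y - x) \<longrightarrow> y \<in> S" by blast
    thus "\<exists>e>0. \<forall>y. laurent_abs (y - x) < e \<longrightarrow> y \<in> S"
      by (intro exI[of _ "real CARD('a) powi (- int m)"])
        (use one_less_CARD_field[where 'a='a] in \<open>auto simp: laurent_abs_less_iff\<close>)
  qed
  thus ?thesis by (simp add: open_fls_iff_subdegree)
qed

lemma normalized_haar_exists: "\<exists>\<nu> :: 'a::{field,finite} fls measure. normalized_haar \<nu>"
proof -
  define U :: "'a measure" where "U = uniform_count_measure UNIV"
  define M :: "(nat \<Rightarrow> 'a) measure" where "M = Pi\<^sub>M UNIV (\<lambda>_. U)"
  define f :: "(nat \<Rightarrow> 'a) \<Rightarrow> 'a fls" where "f = (\<lambda>\<omega>. fls_X * fps_to_fls (Abs_fps \<omega>))"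
  have U: "prob_space U"
    unfolding U_def by (rule prob_space_uniform_count_measure) auto
  interpret P: product_prob_space "\<lambda>_::nat. U" UNIV
    by (intro product_prob_spaceI U)
  have setsU: "sets U = UNIV" "space U = UNIV"
    by (auto simp: U_def sets_uniform_count_measure space_uniform_count_measure)
  have spM: "space M = UNIV" by (simp add: M_def space_PiM setsU)
  have f_nth: "f \<omega> $$ n = (if n \<le> 0 then 0 else \<omega> (nat (n - 1)))" for \<omega> n
    by (simp add: f_def fls_X_times_conv_shift)
  have f_I: "f \<omega> \<in> unit_ideal" for \<omega>
    by (simp add: unit_ideal_iff f_nth)
  have f_surj: "\<exists>\<alpha>. a = f \<alpha>" if "a \<in> unit_ideal" for a
  proof
    show "a = f (\<lambda>n. a $$ (int n + 1))"
      using that by (intro fls_eqI) (auto simp: unit_ideal_iff f_nth)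
  qed
  have comp: "(\<lambda>\<omega>. \<omega> i) \<in> measurable M U" for i
    unfolding M_def by (rule measurable_component_singleton) simp
  have cyl: "{\<omega>. \<forall>i<length w. \<omega> i = w ! i} \<in> sets M" for w
  proof -
    have "(\<lambda>\<omega>. \<omega> i) -` {w ! i} \<inter> space M \<in> sets M" for i
      using comp by (rule measurable_sets) (simp add: setsU)
    hence "{\<omega>. \<omega> i = w ! i} \<in> sets M" for i
      by (simp add: spM vimage_def)
    hence "{\<omega>\<in>space M. \<forall>i\<in>{..<length w}. \<omega> i = w ! i} \<in> sets M"
      by (intro sets.sets_Collect_finite_All) (auto simp: spM)
    thus ?thesis by (simp add: spM lessThan_def)
  qed
  have f_borel: "f \<in> borel_measurable M"
  proof (rule borel_measurableI)
    fix S :: "'a fls set" assume S: "open S"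
    define W where "W = {w. {\<omega>. \<forall>i<length w. \<omega> i = w ! i} \<subseteq> f -` S}"
    have "f -` S = (\<Union>w\<in>W. {\<omega>. \<forall>i<length w. \<omega> i = w ! i})"
    proof (intro equalityI subsetI)
      fix \<omega> assume "\<omega> \<in> f -` S"
      hence "f \<omega> \<in> S" by simp
      with S[unfolded open_fls_iff_subdegree] have
        "\<exists>m::nat. \<forall>y. y = f \<omega> \<or> int m < fls_subdegree (y - f \<omega>) \<longrightarrow> y \<in> S"
        by (rule bspec)
      then obtain m :: nat
        where m: "\<And>y. y = f \<omega> \<or> int m < fls_subdegree (y - f \<omega>) \<Longrightarrow> y \<in> S"
        by blast
      define w where "w = map \<omega> [0..<m]"
      have "f \<omega>' \<in> S" if "\<forall>i<m. \<omega>' i = \<omega> i" for \<omega>'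
      proof (rule m)
        show "f \<omega>' = f \<omega> \<or> int m < fls_subdegree (f \<omega>' - f \<omega>)"
        proof (rule disjCI, rule ccontr)
          assume *: "f \<omega>' \<noteq> f \<omega>" "\<not> int m < fls_subdegree (f \<omega>' - f \<omega>)"
          have "(f \<omega>' - f \<omega>) $$ n = 0" if "n \<le> int m" for n
            using that \<open>\<forall>i<m. \<omega>' i = \<omega> i\<close> by (auto simp: f_nth)
          with * show False
            by (metis not_le nth_fls_subdegree_nonzero right_minus_eq linorder_not_less)
        qed
      qed
      hence "w \<in> W" by (auto simp: W_def w_def)
      moreover have "\<forall>i<length w. \<omega> i = w ! i" by (simp add: w_def)
      ultimately show "\<omega> \<in> (\<Union>w\<in>W. {\<omega>. \<forall>i<length w. \<omega> i = w ! i})" by blast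
    qed (auto simp: W_def)
    moreover have "(\<Union>w\<in>W. {\<omega>. \<forall>i<length w. \<omega> i = w ! i}) \<in> sets M"
      by (intro sets.countable_UN'' cyl) auto
    ultimately show "f -` S \<inter> space M \<in> sets M" by (simp add: spM)
  qed
  hence f_meas: "f \<in> measurable M (restrict_space borel unit_ideal)"
    by (intro measurable_restrict_space2) (auto simp: f_I)
  define \<nu> where "\<nu> = distr M (restrict_space borel unit_ideal) f"
  have sp: "space (restrict_space borel (unit_ideal :: 'a fls set)) = unit_ideal"
    by (simp add: space_restrict_space)
  have em: "emeasure \<nu> B = emeasure M (f -` B)" if "B \<in> sets (restrict_space borel unit_ideal)" for B
    using f_meas that by (simp add: \<nu>_def emeasure_distr spM)
  have "unit_ideal \<in> sets (restrict_space borel (unit_ideal :: 'a fls set))"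
    using sets.top[of "restrict_space borel (unit_ideal :: 'a fls set)"] by (simp add: sp)
  moreover have "f -` unit_ideal = space M" by (auto simp: f_I spM)
  moreover have "emeasure M (space M) = 1"
    unfolding M_def by (rule P.P.emeasure_space_1)
  ultimately have one: "emeasure \<nu> unit_ideal = 1" by (simp add: em)
  have inv: "emeasure \<nu> ((\<lambda>x. a + x) ` B) = emeasure \<nu> B"
    if a: "a \<in> unit_ideal" and B: "B \<in> sets (restrict_space borel unit_ideal)" for a B
  proof -
    obtain \<alpha> where \<alpha>: "a = f \<alpha>" using f_surj a by blast
    have BI: "B \<subseteq> unit_ideal" using sets.sets_into_space[OF B] by (simp add: sp)
    have minus_I: "x - a \<in> unit_ideal" if "x \<in> unit_ideal" for x
      using that a by (simp add: unit_ideal_iff)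
    have plus_I: "a + x \<in> unit_ideal" if "x \<in> unit_ideal" for x
      using that a by (simp add: unit_ideal_iff)
    have "continuous_on UNIV (\<lambda>x. x - a)"
      unfolding continuous_on_iff by (auto simp: dist_fls_def)
    hence "(\<lambda>x. x - a) \<in> borel_measurable borel"
      by (rule borel_measurable_continuous_onI)
    hence meas: "(\<lambda>x. x - a) \<in> measurable (restrict_space borel unit_ideal) (restrict_space borel unit_ideal)"
      by (intro measurable_restrict_space2 measurable_restrict_space1) (auto simp: sp minus_I)
    have img: "(\<lambda>x. a + x) ` B = (\<lambda>x. x - a) -` B \<inter> unit_ideal"
    proof (intro equalityI subsetI)
      fix x assume "x \<in> (\<lambda>x. x - a) -` B \<inter> unit_ideal"
      hence "x - a \<in> B" "x = a + (x - a)" by simp_all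
      thus "x \<in> (\<lambda>x. a + x) ` B" by blast
    qed (use BI plus_I in auto)
    have img_sets: "(\<lambda>x. a + x) ` B \<in> sets (restrict_space borel unit_ideal)"
      using measurable_sets[OF meas B] by (simp add: img sp)
    define s :: "(nat \<Rightarrow> 'a) \<Rightarrow> nat \<Rightarrow> 'a" where "s = (\<lambda>\<omega> i. \<omega> i - \<alpha> i)"
    have s_meas: "s \<in> measurable M M"
    proof -
      have "(\<lambda>\<omega>. \<omega> i - \<alpha> i) \<in> measurable M U" for i
        by (rule measurable_compose[OF comp, where g = "\<lambda>c. c - \<alpha> i"])
          (simp add: measurable_def setsU)
      thus ?thesis
        unfolding s_def by (subst (2) M_def, intro measurable_PiM_single') (auto simp: setsU)
    qed
    have "Pi\<^sub>M UNIV (\<lambda>_. U) = distr M M s"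
    proof (rule measure_eqI_PiM_infinite)
      show "sets (Pi\<^sub>M UNIV (\<lambda>_. U)) = sets (Pi\<^sub>M UNIV (\<lambda>_. U))" ..
      show "sets (distr M M s) = sets (Pi\<^sub>M UNIV (\<lambda>_. U))" by (simp add: M_def)
      show "finite_measure (Pi\<^sub>M UNIV (\<lambda>_::nat. U))" by unfold_locales
    next
      fix A :: "nat \<Rightarrow> 'a set" and J :: "nat set"
      assume J: "finite J"
      have eA: "prod_emb UNIV (\<lambda>_. U) J (Pi\<^sub>E J A') \<in> sets M" for A'
        unfolding M_def by (intro sets_PiM_I J) (auto simp: setsU)
      have "s -` prod_emb UNIV (\<lambda>_. U) J (Pi\<^sub>E J A) = prod_emb UNIV (\<lambda>_. U) J (\<Pi>\<^sub>E i\<in>J. (\<lambda>c. c + \<alpha> i) ` A i)"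
      proof -
        have "c - \<alpha> i \<in> A i \<longleftrightarrow> c \<in> (\<lambda>c. c + \<alpha> i) ` A i" for c i
          by (auto intro!: image_eqI[of _ _ "c - \<alpha> i"])
        thus ?thesis
          by (simp add: set_eq_iff prod_emb_def setsU s_def PiE_iff extensional_def restrict_def)
      qed
      hence "emeasure (distr M M s) (prod_emb UNIV (\<lambda>_. U) J (Pi\<^sub>E J A)) =
          emeasure M (prod_emb UNIV (\<lambda>_. U) J (\<Pi>\<^sub>E i\<in>J. (\<lambda>c. c + \<alpha> i) ` A i))"
        using s_meas eA by (simp add: emeasure_distr spM)
      also have "\<dots> = (\<Prod>i\<in>J. emeasure U ((\<lambda>c. c + \<alpha> i) ` A i))"
        unfolding M_def using J by (intro P.emeasure_PiM_emb) (auto simp: setsU)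
      also have "\<dots> = (\<Prod>i\<in>J. emeasure U (A i))"
        by (intro prod.cong refl)
          (simp add: U_def emeasure_uniform_count_measure card_image)
      also have "\<dots> = emeasure (Pi\<^sub>M UNIV (\<lambda>_. U)) (prod_emb UNIV (\<lambda>_. U) J (Pi\<^sub>E J A))"
        using J by (intro P.emeasure_PiM_emb[symmetric]) (auto simp: setsU)
      finally show "emeasure (Pi\<^sub>M UNIV (\<lambda>_. U)) (prod_emb UNIV (\<lambda>_. U) J (Pi\<^sub>E J A)) =
          emeasure (distr M M s) (prod_emb UNIV (\<lambda>_. U) J (Pi\<^sub>E J A))" ..
    qed
    hence dM: "M = distr M M s" by (simp add: M_def)
    have fs: "f \<omega> - a = f (s \<omega>)" for \<omega>
      by (rule fls_eqI) (simp add: \<alpha> f_nth s_def)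
    have fB: "f -` B \<in> sets M"
      using measurable_sets[OF f_meas B] by (simp add: spM)
    have "emeasure \<nu> ((\<lambda>x. a + x) ` B) = emeasure M (f -` ((\<lambda>x. a + x) ` B))"
      by (rule em[OF img_sets])
    also have "f -` ((\<lambda>x. a + x) ` B) = s -` (f -` B)"
      unfolding img by (auto simp: fs f_I)
    also have "emeasure M (s -` (f -` B)) = emeasure (distr M M s) (f -` B)"
      using s_meas fB by (simp add: emeasure_distr spM)
    also have "\<dots> = emeasure \<nu> B" by (simp add: em[OF B] flip: dM)
    finally show ?thesis .
  qed
  have "normalized_haar \<nu>"
    unfolding normalized_haar_def using one inv by (auto simp: \<nu>_def)
  thus ?thesis by blast
qed

end

theory Submission
  imports Defs
begin

text \<open>
  On the set where the first partial quotient equals $P$, the Gauss map is a bijection onto the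
  unit ideal which expands all distances by $q^{2 \deg P}$. Hence it preserves the Haar measure and
  its value is independent of the first partial quotient, so the degrees of the partial quotients
  are independent with the geometric law $(q - 1) q^{-d}$. The probability that $k$ of them sum up
  to at least $m$ is of order $m^{k-1} q^{-m}$. The convergence case is then the first
  Borel--Cantelli lemma. In the divergence case the series already diverges along some residue
  class of $n$ modulo $k$, and the second Borel--Cantelli lemma applies, as blocks of $k$ partial
  quotients starting there do not overlap.
\<close>

subsection \<open>Series\<close>

text \<open>The order m^(k-1) q^-m is a count: m is an ordered sum of k positive degrees in
  binom(m-1, k-1) ways, and each pattern has probability (q-1)^k q^-m. Independence enters only as
  independence of the first digit from every event about \<open>T x\<close>. Arguments on blocks
  therefore peel off a first digit or a first block and induct, and joint independence of the whole
  digit sequence never has to be formulated. Terminating expansions are handled by the digit itself: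
  once an orbit reaches 0 its digits are 0, while \<open>heavy\<close> asks for positive digits. For
  Laurent series, balls are the natural test events, since the inverse branches map balls to balls;
  a Dynkin argument passes to all Borel sets.\<close>

lemma not_summable_residue:
  fixes f :: "nat \<Rightarrow> real"
  assumes nn: "\<And>n. f n \<ge> 0" and "k > 0" and "\<not> summable f"
  shows "\<exists>r<k. \<not> summable (\<lambda>j. f (r + k * j))"
proof -
  have "summable f" if sm: "\<And>r. r < k \<Longrightarrow> summable (\<lambda>j. f (r + k * j))"
  proof (rule bounded_imp_summable)
    fix n
    \<comment> \<open>The first n + 1 terms lie among the first (n + 1) k, which split into k
      residue classes of n + 1 terms each. The series over the classes then bound all partial sums
      uniformly in n.\<close>
    have "Suc n * 1 \<le> Suc n * k"
      using \<open>k > 0\<close> by (intro mult_le_mono) auto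
    hence "(\<Sum>i\<le>n. f i) \<le> (\<Sum>i<Suc n * k. f i)"
      by (intro sum_mono2 nn) auto
    also have "\<dots> = (\<Sum>m<Suc n. \<Sum>r<k. f (r + m * k))"
      by (simp only: sum.nat_group[symmetric] sum.atLeastLessThan_shift_0 flip: lessThan_atLeast0)
        (simp add: add.commute)
    also have "\<dots> = (\<Sum>r<k. \<Sum>m<Suc n. f (r + k * m))"
      by (subst sum.swap) (simp add: mult.commute)
    also have "\<dots> \<le> (\<Sum>r<k. \<Sum>m. f (r + k * m))"
      by (intro sum_mono sum_le_suminf sm nn) auto
    finally show "(\<Sum>i\<le>n. f i) \<le> (\<Sum>r<k. \<Sum>m. f (r + k * m))" .
  qed (rule nn)
  with assms show ?thesis by blast
qed

text \<open>The analytic half of the second Borel--Cantelli lemma: 1 - t <= exp (- t) bounds the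
  product by the exponential of minus a divergent partial sum.\<close>

lemma prod_one_minus_tendsto_0:
  fixes g :: "nat \<Rightarrow> real"
  assumes g: "\<And>n. 0 \<le> g n" "\<And>n. g n \<le> 1" and ns: "\<not> summable g"
  shows "(\<lambda>n. \<Prod>i<n. 1 - g i) \<longlonglongrightarrow> 0"
proof (rule tendsto_sandwich)
  show "\<forall>\<^sub>F n in sequentially. 0 \<le> (\<Prod>i<n. 1 - g i)"
    using g by (intro always_eventually allI prod_nonneg) auto
  have "(\<Prod>i<n. 1 - g i) \<le> exp (- (\<Sum>i<n. g i))" for n
  proof -
    have "(\<Prod>i<n. 1 - g i) \<le> (\<Prod>i<n. exp (- g i))"
      using g exp_ge_add_one_self[of "- g _"] by (intro prod_mono) auto
    thus ?thesis by (simp add: exp_sum flip: sum_negf)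
  qed
  thus "\<forall>\<^sub>F n in sequentially. (\<Prod>i<n. 1 - g i) \<le> exp (- (\<Sum>i<n. g i))" by simp
  have "filterlim (\<lambda>n. \<Sum>i<n. g i) at_top sequentially"
    unfolding filterlim_at_top eventually_sequentially
  proof (intro allI)
    fix Z
    have "\<exists>N. Z < (\<Sum>i\<le>N. g i)"
    proof (rule ccontr)
      assume "\<nexists>N. Z < (\<Sum>i\<le>N. g i)"
      hence "(\<Sum>i\<le>n. g i) \<le> Z" for n by (simp add: not_less)
      with g(1) have "summable g" by (rule bounded_imp_summable)
      with ns show False ..
    qed
    then obtain N where N: "Z < (\<Sum>i\<le>N. g i)" ..
    have "Z \<le> (\<Sum>i<n. g i)" if "n \<ge> Suc N" for n
      using N sum_mono2[of "{..<n}" "{..N}" g] g that by force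
    thus "\<exists>N. \<forall>n\<ge>N. Z \<le> (\<Sum>i<n. g i)" by blast
  qed
  thus "(\<lambda>n. exp (- (\<Sum>i<n. g i))) \<longlonglongrightarrow> 0"
    by (auto intro!: filterlim_compose[OF exp_at_bot] simp: filterlim_uminus_at_bot)
qed simp

subsection \<open>Independent digits\<close>

text \<open>
  The digits of $x$ are $D(x), D(T x), D(T^2 x), \dots$. Since \<open>B\<close> may be any event, \<open>indep\<close>
  makes them independent and identically distributed. The digit $0$ stands for an undefined one.
\<close>

locale digit_process = prob_space M for M :: "'a measure" +
  fixes T :: "'a \<Rightarrow> 'a" and D :: "'a \<Rightarrow> nat"
  assumes T_meas [measurable]: "T \<in> measurable M M"
    and D_meas [measurable]: "D \<in> measurable M (count_space UNIV)"
    and indep: "B \<in> sets M \<Longrightarrow>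
      prob {x \<in> space M. D x = d \<and> T x \<in> B} = prob {x \<in> space M. D x = d} * prob B"
begin

text \<open>Total probability over the first digit. The event for \<open>T x\<close> may depend on
  that digit, because in \<open>heavy\<close> the remaining threshold does.\<close>

lemma digit_sums:
  assumes [measurable]: "\<And>d. E d \<in> sets M"
  shows "(\<lambda>d. prob {x \<in> space M. D x = d} * prob (E d)) sums prob {x \<in> space M. T x \<in> E (D x)}"
proof -
  have "(\<lambda>d. prob {x \<in> space M. D x = d \<and> T x \<in> E d}) sums
      prob (\<Union>d. {x \<in> space M. D x = d \<and> T x \<in> E d})"
    by (rule finite_measure_UNION) (auto simp: disjoint_family_on_def)
  moreover have "(\<Union>d. {x \<in> space M. D x = d \<and> T x \<in> E d}) = {x \<in> space M. T x \<in> E (D x)}"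
    by auto
  ultimately show ?thesis using assms by (simp add: indep)
qed

lemma digit_sets [measurable]:
  assumes [measurable]: "\<And>d. E d \<in> sets M"
  shows "{x \<in> space M. T x \<in> E (D x)} \<in> sets M"
proof -
  have "{x \<in> space M. T x \<in> E (D x)} = (\<Union>d. {x \<in> space M. D x = d \<and> T x \<in> E d})"
    by auto
  also have "\<dots> \<in> sets M" by measurable
  finally show ?thesis .
qed

lemma prob_digit_sums: "(\<lambda>d. prob {x \<in> space M. D x = d}) sums 1"
proof -
  have "{x \<in> space M. T x \<in> space M} = space M"
    using measurable_space[OF T_meas] by auto
  thus ?thesis using digit_sums[of "\<lambda>_. space M"] by (simp add: prob_space)
qed

text \<open>Invariance of the measure is a consequence of \<open>indep\<close>: given any value of
  the digit, \<open>T x\<close> has the law of x, and the digit probabilities add up to 1.\<close>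

lemma prob_shift:
  assumes "B \<in> sets M"
  shows "prob {x \<in> space M. T x \<in> B} = prob B"
  using sums_unique2[OF digit_sums[of "\<lambda>_. B"] sums_mult2[OF prob_digit_sums]] assms by simp

lemma measurable_funpow [measurable]: "T ^^ n \<in> measurable M M"
  by (rule measurable_compose_n) (rule T_meas)

lemma prob_funpow:
  assumes [measurable]: "B \<in> sets M"
  shows "prob {x \<in> space M. (T ^^ n) x \<in> B} = prob B"
proof (induction n)
  case 0
  show ?case using sets.sets_into_space[OF assms] by (auto intro: arg_cong[where f = prob])
next
  case (Suc n)
  have "{x \<in> space M. (T ^^ Suc n) x \<in> B} = {x \<in> space M. T x \<in> {x \<in> space M. (T ^^ n) x \<in> B}}"
    using measurable_space[OF T_meas] by (auto simp: funpow_swap1)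
  thus ?case using Suc by (simp only:) (subst prob_shift, auto)
qed

text \<open>The recursion exposes the first digit, so that \<open>indep\<close> applies to it.
  Truncated subtraction turns a threshold that has been passed into 0; from then on only positivity
  of the remaining digits is asked for, that is, that the partial quotients are defined.\<close>

primrec heavy :: "nat \<Rightarrow> nat \<Rightarrow> 'a set" where
  "heavy 0 m = (if m = 0 then space M else {})"
| "heavy (Suc k) m = {x \<in> space M. 0 < D x \<and> T x \<in> heavy k (m - D x)}"

lemma heavy_sets [measurable]: "heavy k m \<in> sets M"
proof (induction k arbitrary: m)
  case (Suc k)
  note Suc [measurable]
  have [measurable]: "{x \<in> space M. T x \<in> heavy k (m - D x)} \<in> sets M"
    by (rule digit_sets) (rule Suc)
  have "heavy (Suc k) m = {x \<in> space M. 0 < D x} \<inter> {x \<in> space M. T x \<in> heavy k (m - D x)}"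
    by auto
  thus ?case by simp
qed auto

lemma in_heavy_iff:
  "x \<in> heavy k m \<longleftrightarrow> x \<in> space M \<and> (\<forall>i\<in>{1..k}. 0 < D ((T ^^ (i - 1)) x)) \<and>
     m \<le> (\<Sum>i=1..k. D ((T ^^ (i - 1)) x))"
proof (induction k arbitrary: x m)
  case (Suc k)
  have T: "T x \<in> space M" if "x \<in> space M"
    using measurable_space[OF T_meas] that .
  have shift: "(T ^^ (i - 1)) (T x) = (T ^^ (Suc i - 1)) x" if "i \<in> {1..k}" for i
    using that by (cases i) (auto simp: funpow_swap1)
  have ball: "(\<forall>i\<in>{1..Suc k}. P i) \<longleftrightarrow> P 1 \<and> (\<forall>i\<in>{1..k}. P (Suc i))" for P :: "nat \<Rightarrow> bool"
  proof -
    have *: "{1..Suc k} = insert 1 (Suc ` {1..k})" by (auto simp: image_Suc_atLeastAtMost)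
    show ?thesis unfolding * by blast
  qed
  have sum: "(\<Sum>i=1..Suc k. f i) = f 1 + (\<Sum>i=1..k. f (Suc i))" for f :: "nat \<Rightarrow> nat"
    by (subst sum.atLeast_Suc_atMost) (auto simp flip: sum.shift_bounds_cl_Suc_ivl)
  have "x \<in> heavy (Suc k) m \<longleftrightarrow> x \<in> space M \<and> 0 < D x \<and>
      (\<forall>i\<in>{1..k}. 0 < D ((T ^^ (Suc i - 1)) x)) \<and>
      m \<le> D x + (\<Sum>i=1..k. D ((T ^^ (Suc i - 1)) x))"
    using T shift by (auto simp: Suc.IH)
  thus ?case unfolding ball sum by simp
qed auto

text \<open>Lifts \<open>indep\<close> from one digit to a block of k digits: both sides expand into
  the same series over the first digit, and the induction hypothesis pulls the factor
  \<open>prob B\<close> out of each term.\<close>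

lemma heavy_indep:
  assumes [measurable]: "B \<in> sets M"
  shows "prob {x \<in> heavy k m. (T ^^ k) x \<in> B} = prob (heavy k m) * prob B"
proof (induction k arbitrary: m)
  case 0
  show ?case using sets.sets_into_space[OF assms] by (auto simp: prob_space intro: arg_cong[where f = prob])
next
  case (Suc k)
  \<comment> \<open>What \<open>T x\<close> has to satisfy when the first digit is d; the empty set
    at d = 0 absorbs the condition \<open>0 < D x\<close>.\<close>
  define E where "E d = (if d = 0 then {} else heavy k (m - d))" for d
  define E' where "E' d = {x \<in> E d. (T ^^ k) x \<in> B}" for d
  have E [measurable]: "E d \<in> sets M" for d by (simp add: E_def)
  have "E' d = E d \<inter> {x \<in> space M. (T ^^ k) x \<in> B}" for d
    using sets.sets_into_space[OF E] by (auto simp: E'_def)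
  hence E' [measurable]: "E' d \<in> sets M" for d by simp
  have prob_E': "prob (E' d) = prob (E d) * prob B" for d
    using Suc by (simp add: E_def E'_def)
  have 1: "heavy (Suc k) m = {x \<in> space M. T x \<in> E (D x)}"
    by (auto simp: E_def)
  have 2: "{x \<in> heavy (Suc k) m. (T ^^ Suc k) x \<in> B} = {x \<in> space M. T x \<in> E' (D x)}"
    unfolding 1 by (auto simp: E'_def funpow_swap1)
  have "(\<lambda>d. prob {x \<in> space M. D x = d} * prob (E' d)) sums prob {x \<in> space M. T x \<in> E' (D x)}"
    by (rule digit_sums) (rule E')
  moreover have "(\<lambda>d. prob {x \<in> space M. D x = d} * prob (E' d)) sums
      (prob {x \<in> space M. T x \<in> E (D x)} * prob B)"
    unfolding prob_E' mult.assoc[symmetric] by (intro sums_mult2 digit_sums E)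
  ultimately show ?case unfolding 2 unfolding 1 by (rule sums_unique2)
qed

text \<open>Blocks of length k starting at multiples of k do not overlap. The induction removes the
  first block; what remains is the same kind of event for \<open>(T ^^ k) x\<close> and the
  thresholds shifted by one, hence the generalisation over \<Psi>.\<close>

lemma prob_avoid:
  "prob {x \<in> space M. \<forall>j<n. (T ^^ (k * j)) x \<notin> heavy k (\<Psi> j)} =
     (\<Prod>j<n. 1 - prob (heavy k (\<Psi> j)))"
proof (induction n arbitrary: \<Psi>)
  case (Suc n)
  define B where "B = {x \<in> space M. \<forall>j<n. (T ^^ (k * j)) x \<notin> heavy k (\<Psi> (Suc j))}"
  have B [measurable]: "B \<in> sets M" unfolding B_def by measurable
  have Tk: "(T ^^ k) x \<in> space M" if "x \<in> space M" for x
    using measurable_space[OF measurable_funpow] that .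
  have "{x \<in> space M. \<forall>j<Suc n. (T ^^ (k * j)) x \<notin> heavy k (\<Psi> j)} =
      {x \<in> space M. (T ^^ k) x \<in> B} - {x \<in> heavy k (\<Psi> 0). (T ^^ k) x \<in> B}"
    using Tk by (auto simp: B_def All_less_Suc2 funpow_add[symmetric, unfolded o_def, THEN fun_cong]
        add.commute)
  moreover have "{x \<in> heavy k (\<Psi> 0). (T ^^ k) x \<in> B} =
      heavy k (\<Psi> 0) \<inter> {x \<in> space M. (T ^^ k) x \<in> B}"
    using sets.sets_into_space[OF heavy_sets] by auto
  moreover have "prob ({x \<in> space M. (T ^^ k) x \<in> B} - heavy k (\<Psi> 0) \<inter> {x \<in> space M. (T ^^ k) x \<in> B})
      = prob {x \<in> space M. (T ^^ k) x \<in> B} - prob (heavy k (\<Psi> 0) \<inter> {x \<in> space M. (T ^^ k) x \<in> B})"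
    by (rule finite_measure_Diff) auto
  ultimately have "prob {x \<in> space M. \<forall>j<Suc n. (T ^^ (k * j)) x \<notin> heavy k (\<Psi> j)} =
      (1 - prob (heavy k (\<Psi> 0))) * prob B"
    using heavy_indep[OF B, of k "\<Psi> 0"] prob_funpow[OF B, of k] by (simp add: algebra_simps)
  thus ?case unfolding prod.lessThan_Suc_shift B_def by (simp add: Suc.IH)
qed (simp add: prob_space)

definition infinitely_often_heavy :: "nat \<Rightarrow> (nat \<Rightarrow> nat) \<Rightarrow> 'a set" where
  "infinitely_often_heavy k \<Psi> = {x \<in> space M. infinite {n. (T ^^ n) x \<in> heavy k (\<Psi> n)}}"

lemma infinitely_often_heavy_sets [measurable]: "infinitely_often_heavy k \<Psi> \<in> sets M"
  unfolding infinitely_often_heavy_def infinite_nat_iff_unbounded_le mem_Collect_eq by measurable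

lemma prob_infinitely_often_heavy_0:
  assumes "summable (\<lambda>n. prob (heavy k (\<Psi> n)))"
  shows "prob (infinitely_often_heavy k \<Psi>) = 0"
proof -
  let ?A = "\<lambda>n. {x \<in> space M. (T ^^ n) x \<in> heavy k (\<Psi> n)}"
  have "limsup ?A \<in> null_sets M"
    using assms by (intro borel_cantelli_limsup1) (auto simp: prob_funpow emeasure_eq_measure)
  moreover have "limsup ?A = infinitely_often_heavy k \<Psi>"
    by (auto simp: limsup_INF_SUP infinitely_often_heavy_def infinite_nat_iff_unbounded_le)
  ultimately show ?thesis by (simp add: measure_eq_0_null_sets)
qed

text \<open>Let r be a residue class with divergent series. If x is heavy only finitely often, then
  for some a no block starting at r + k j with j >= a is heavy, so
  \<open>(T ^^ (r + k * a)) x\<close> lies in \<open>N a\<close>. This set is null since dropping a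
  terms keeps the divergence, and there are countably many a.\<close>

lemma prob_infinitely_often_heavy_1:
  assumes "k > 0" and "\<not> summable (\<lambda>n. prob (heavy k (\<Psi> n)))"
  shows "prob (infinitely_often_heavy k \<Psi>) = 1"
proof -
  have "\<exists>r<k. \<not> summable (\<lambda>j. prob (heavy k (\<Psi> (r + k * j))))"
    by (rule not_summable_residue) (use assms in auto)
  then obtain r where r: "\<not> summable (\<lambda>j. prob (heavy k (\<Psi> (r + k * j))))" by blast
  define \<Psi>' where "\<Psi>' a j = \<Psi> (r + k * (j + a))" for a j
  define N where "N a = {x \<in> space M. \<forall>j. (T ^^ (k * j)) x \<notin> heavy k (\<Psi>' a j)}" for a
  have N_sets [measurable]: "N a \<in> sets M" for a unfolding N_def by measurable
  have "prob (N a) = 0" for a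
  proof -
    have "(\<lambda>n. \<Prod>j<n. 1 - prob (heavy k (\<Psi>' a j))) \<longlonglongrightarrow> 0"
      using r summable_iff_shift[of "\<lambda>j. prob (heavy k (\<Psi> (r + k * j)))" a]
      by (intro prod_one_minus_tendsto_0) (auto simp: \<Psi>'_def)
    moreover have "prob (N a) \<le> (\<Prod>j<n. 1 - prob (heavy k (\<Psi>' a j)))" for n
      unfolding prob_avoid[symmetric] by (intro finite_measure_mono) (auto simp: N_def)
    ultimately have "prob (N a) \<le> 0" by (intro LIMSEQ_le_const) auto
    thus ?thesis by (simp add: measure_le_0_iff)
  qed
  hence null: "{x \<in> space M. (T ^^ (r + k * a)) x \<in> N a} \<in> null_sets M" for a
    by (intro null_setsI) (auto simp: emeasure_eq_measure prob_funpow)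
  have "AE x in M. x \<notin> {x \<in> space M. (T ^^ (r + k * a)) x \<in> N a}" for a
    by (rule AE_not_in[OF null])
  hence "AE x in M. \<forall>a. x \<notin> {x \<in> space M. (T ^^ (r + k * a)) x \<in> N a}"
    by (simp add: AE_all_countable)
  hence "AE x in M. x \<in> infinitely_often_heavy k \<Psi>"
  proof (rule AE_mp, intro AE_I2 impI)
    fix x assume x: "x \<in> space M" and *: "\<forall>a. x \<notin> {x \<in> space M. (T ^^ (r + k * a)) x \<in> N a}"
    have "\<exists>n\<ge>a. (T ^^ n) x \<in> heavy k (\<Psi> n)" for a
    proof -
      have "(T ^^ (r + k * a)) x \<in> space M" by (rule measurable_space[OF measurable_funpow x])
      with * x obtain j where "(T ^^ (k * j)) ((T ^^ (r + k * a)) x) \<in> heavy k (\<Psi>' a j)"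
        by (auto simp: N_def)
      hence "(T ^^ (r + k * (j + a))) x \<in> heavy k (\<Psi> (r + k * (j + a)))"
        by (simp add: \<Psi>'_def algebra_simps funpow_add[symmetric, unfolded o_def, THEN fun_cong])
      moreover have "a \<le> r + k * (j + a)"
      proof -
        have "1 * (j + a) \<le> k * (j + a)"
          using \<open>k > 0\<close> by (intro mult_le_mono) auto
        thus ?thesis by (metis add_leD2 mult_1 trans_le_add2)
      qed
      ultimately show ?thesis by blast
    qed
    thus "x \<in> infinitely_often_heavy k \<Psi>"
      using x by (auto simp: infinitely_often_heavy_def infinite_nat_iff_unbounded_le)
  qed
  thus ?thesis by (subst prob_eq_1) auto
qed

end

subsection \<open>Geometrically distributed digits\<close>

text \<open>The prescribed probabilities for d >= 1 already add up to 1, so the digit 0 has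
  probability 0.\<close>

locale geometric_process = digit_process +
  fixes q :: real
  assumes q: "1 < q"
    and prob_digit: "d \<ge> 1 \<Longrightarrow> prob {x \<in> space M. D x = d} = (q - 1) / q ^ d"
begin

lemma prob_digit_ge:
  assumes "m \<ge> 1"
  shows "prob {x \<in> space M. m \<le> D x} = q / q ^ m"
proof -
  have "(\<Union>i. {x \<in> space M. D x = m + i}) = {x \<in> space M. m \<le> D x}"
    by (auto simp: le_iff_add)
  moreover have "(\<lambda>i. prob {x \<in> space M. D x = m + i}) sums prob (\<Union>i. {x \<in> space M. D x = m + i})"
    by (rule finite_measure_UNION) (auto simp: disjoint_family_on_def)
  moreover have "prob {x \<in> space M. D x = m + i} = (q - 1) / q ^ m * (1 / q) ^ i" for i
    using assms by (simp add: prob_digit power_add power_divide)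
  ultimately have "(\<lambda>i. (q - 1) / q ^ m * (1 / q) ^ i) sums prob {x \<in> space M. m \<le> D x}"
    by (simp only:)
  moreover have "(\<lambda>i. (q - 1) / q ^ m * (1 / q) ^ i) sums ((q - 1) / q ^ m * (1 / (1 - 1 / q)))"
    using q by (intro sums_mult geometric_sums) auto
  ultimately have "prob {x \<in> space M. m \<le> D x} = (q - 1) / q ^ m * (1 / (1 - 1 / q))"
    by (rule sums_unique2)
  also have "1 / (1 - 1 / q) = q / (q - 1)" using q by (simp add: field_simps)
  finally show ?thesis using q by simp
qed

text \<open>Induction on the number of digits, split by the first digit d. The case d >= m costs the
  tail q / q^m. For d < m the factors q^-d and q^-(m-d) combine to q^-m, and the fewer than m
  choices of d supply one more power of m.\<close>

lemma prob_heavy_le: "\<exists>C. \<forall>m\<ge>1. prob (heavy (Suc k) m) \<le> C * real m ^ k / q ^ m"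
proof (induction k)
  case 0
  have "heavy (Suc 0) m \<subseteq> {x \<in> space M. m \<le> D x}" if "m \<ge> 1" for m by auto
  hence "prob (heavy (Suc 0) m) \<le> q / q ^ m" if "m \<ge> 1" for m
    unfolding prob_digit_ge[OF that, symmetric] using that by (intro finite_measure_mono) auto
  thus ?case by (intro exI[of _ q]) auto
next
  case (Suc k)
  then obtain C where C: "\<And>m. m \<ge> 1 \<Longrightarrow> prob (heavy (Suc k) m) \<le> C * real m ^ k / q ^ m" by blast
  \<comment> \<open>Read off from m = 1, where the bound is C / q.\<close>
  have "0 \<le> C"
    using order_trans[OF measure_nonneg C[of 1]] q by (simp add: zero_le_divide_iff)
  let ?A = "\<lambda>m d. {x \<in> space M. D x = d \<and> T x \<in> heavy (Suc k) (m - d)}"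
  have "prob (heavy (Suc (Suc k)) m) \<le> (q + (q - 1) * C) * real m ^ Suc k / q ^ m" if m: "m \<ge> 1" for m
  proof -
    have "heavy (Suc (Suc k)) m \<subseteq> {x \<in> space M. m \<le> D x} \<union> (\<Union>d\<in>{1..<m}. ?A m d)"
      by (auto simp del: heavy.simps simp: heavy.simps(2)[of "Suc k"])
    hence "prob (heavy (Suc (Suc k)) m) \<le> prob ({x \<in> space M. m \<le> D x} \<union> (\<Union>d\<in>{1..<m}. ?A m d))"
      by (intro finite_measure_mono) (auto simp del: heavy.simps)
    also have "\<dots> \<le> prob {x \<in> space M. m \<le> D x} + prob (\<Union>d\<in>{1..<m}. ?A m d)"
      by (intro measure_Un_le) (auto simp del: heavy.simps)
    also have "prob (\<Union>d\<in>{1..<m}. ?A m d) \<le> (\<Sum>d\<in>{1..<m}. prob (?A m d))"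
      by (intro finite_measure_subadditive_finite) (auto simp del: heavy.simps)
    also have "\<dots> \<le> (\<Sum>d\<in>{1..<m}. (q - 1) * C * real m ^ k / q ^ m)"
    proof (intro sum_mono)
      fix d assume d: "d \<in> {1..<m}"
      have "prob (?A m d) = (q - 1) / q ^ d * prob (heavy (Suc k) (m - d))"
        using d by (simp add: indep prob_digit del: heavy.simps)
      also have "\<dots> \<le> (q - 1) / q ^ d * (C * real (m - d) ^ k / q ^ (m - d))"
        using q d by (intro mult_left_mono C) auto
      also have "\<dots> = (q - 1) * C * real (m - d) ^ k / q ^ m"
        using q d by (simp add: power_diff)
      also have "\<dots> \<le> (q - 1) * C * real m ^ k / q ^ m"
        using q \<open>0 \<le> C\<close> by (intro divide_right_mono mult_left_mono power_mono) auto
      finally show "prob (?A m d) \<le> (q - 1) * C * real m ^ k / q ^ m" .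
    qed
    also have "\<dots> \<le> real m * ((q - 1) * C * real m ^ k / q ^ m)"
      using q \<open>0 \<le> C\<close> by (auto intro!: mult_right_mono simp del: times_divide_eq_right)
    also have "prob {x \<in> space M. m \<le> D x} \<le> q * real m ^ Suc k / q ^ m"
      unfolding prob_digit_ge[OF m] using q m by (intro divide_right_mono) (auto simp del: power_Suc)
    finally show ?thesis
      by (simp add: algebra_simps add_divide_distrib diff_divide_distrib del: heavy.simps)
  qed
  thus ?case by blast
qed

text \<open>Only sums equal to m are counted: there are \<open>(m - 1) choose k\<close> ordered sums
  of k + 1 positive digits, each of probability (q-1)^(k+1) q^-m. Splitting by the first digit
  reproduces this count through the hockey-stick identity.\<close>

lemma prob_heavy_ge:
  assumes "m \<ge> 1"
  shows "(q - 1) ^ Suc k * real ((m - 1) choose k) / q ^ m \<le> prob (heavy (Suc k) m)"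
  using assms
proof (induction k arbitrary: m)
  case 0
  have "(q - 1) / q ^ m = prob {x \<in> space M. D x = m}"
    using 0 by (simp add: prob_digit)
  also have "\<dots> \<le> prob (heavy (Suc 0) m)"
    using 0 measurable_space[OF T_meas] by (intro finite_measure_mono heavy_sets) auto
  finally show ?case by simp
next
  case (Suc k)
  let ?A = "\<lambda>d. {x \<in> space M. D x = d \<and> T x \<in> heavy (Suc k) (m - d)}"
  have "(\<Sum>d=1..<m. real ((m - d - 1) choose k)) = (\<Sum>i<m - 1. real (i choose k))"
    by (rule sum.reindex_bij_witness[of _ "\<lambda>i. m - 1 - i" "\<lambda>d. m - d - 1"]) auto
  also have "\<dots> = real ((m - 1) choose Suc k)"
  proof (cases "m - 1")
    case (Suc n)
    thus ?thesis using sum_choose_upper[of k n] by (simp add: lessThan_Suc_atMost flip: of_nat_sum)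
  qed simp
  finally have hockey: "(\<Sum>d=1..<m. real ((m - d - 1) choose k)) = real ((m - 1) choose Suc k)" .
  have "(q - 1) ^ Suc (Suc k) * real ((m - 1) choose Suc k) / q ^ m =
      (\<Sum>d=1..<m. (q - 1) ^ Suc (Suc k) * real ((m - d - 1) choose k) / q ^ m)"
    by (simp only: hockey[symmetric] sum_distrib_left sum_divide_distrib)
  also have "\<dots> \<le> (\<Sum>d=1..<m. prob (?A d))"
  proof (intro sum_mono)
    fix d assume d: "d \<in> {1..<m}"
    have "(q - 1) ^ Suc (Suc k) * real ((m - d - 1) choose k) / q ^ m =
        (q - 1) / q ^ d * ((q - 1) ^ Suc k * real ((m - d - 1) choose k) / q ^ (m - d))"
      using q d by (simp add: power_diff)
    also have "\<dots> \<le> (q - 1) / q ^ d * prob (heavy (Suc k) (m - d))"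
      using q d by (intro mult_left_mono Suc.IH) auto
    also have "\<dots> = prob (?A d)"
      using d by (simp add: indep prob_digit del: heavy.simps)
    finally show "(q - 1) ^ Suc (Suc k) * real ((m - d - 1) choose k) / q ^ m \<le> prob (?A d)" .
  qed
  also have "\<dots> = prob (\<Union>d\<in>{1..<m}. ?A d)"
    by (rule finite_measure_finite_Union[symmetric])
      (auto simp: disjoint_family_on_def simp del: heavy.simps)
  also have "\<dots> \<le> prob (heavy (Suc (Suc k)) m)"
    by (intro finite_measure_mono heavy_sets) (auto simp del: heavy.simps simp: heavy.simps(2)[of "Suc k"])
  finally show ?case .
qed

lemma summable_heavy_iff:
  assumes k: "k \<ge> 1" and \<Psi>: "\<And>n. \<Psi> n \<ge> k"
  shows "summable (\<lambda>n. prob (heavy k (\<Psi> n))) \<longleftrightarrow> summable (\<lambda>n. real (\<Psi> n) ^ (k - 1) / q ^ \<Psi> n)"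
proof
  obtain C where C: "\<And>m. m \<ge> 1 \<Longrightarrow> prob (heavy k m) \<le> C * real m ^ (k - 1) / q ^ m"
    using prob_heavy_le[of "k - 1"] k by auto
  assume "summable (\<lambda>n. real (\<Psi> n) ^ (k - 1) / q ^ \<Psi> n)"
  hence "summable (\<lambda>n. C * (real (\<Psi> n) ^ (k - 1) / q ^ \<Psi> n))" by (rule summable_mult)
  thus "summable (\<lambda>n. prob (heavy k (\<Psi> n)))"
    by (rule summable_comparison_test[rotated])
      (use C k \<Psi> in \<open>auto intro!: exI[of _ 0] intro: order_trans\<close>)
next
  define c where "c = (q - 1) ^ k / real k ^ (k - 1)"
  have "c > 0" using q k by (simp add: c_def)
  have "c * (real m ^ (k - 1) / q ^ m) \<le> prob (heavy k m)" if m: "m \<ge> k" for m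
  proof -
    \<comment> \<open>The bound (m choose k) >= (m/k)^k needs m >= k; the absorption identity then
      cancels one factor m/k. This is where \<open>real k ^ (k - 1)\<close> in \<open>c\<close>
      comes from.\<close>
    have "(real m / real k) ^ (k - 1) * (real m / real k) = (real m / real k) ^ k"
      using k by (simp add: power_eq_if)
    also have "\<dots> \<le> real (m choose k)" using m by (rule binomial_ge_n_over_k_pow_k)
    also have "\<dots> = real ((m - 1) choose (k - 1)) * (real m / real k)"
      using k m times_binomial_minus1_eq[of k m, THEN arg_cong[where f = real]]
      by (simp add: field_simps)
    finally have "(real m / real k) ^ (k - 1) \<le> real ((m - 1) choose (k - 1))"
      by (rule mult_right_le_imp_le) (use k m in simp)
    hence "(q - 1) ^ k * (real m / real k) ^ (k - 1) / q ^ m \<le>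
        (q - 1) ^ k * real ((m - 1) choose (k - 1)) / q ^ m"
      using q by (intro divide_right_mono mult_left_mono) auto
    also have "\<dots> \<le> prob (heavy k m)"
      using prob_heavy_ge[of m "k - 1"] k m by simp
    finally show ?thesis by (simp add: c_def power_divide)
  qed
  note lower = this
  assume "summable (\<lambda>n. prob (heavy k (\<Psi> n)))"
  hence "summable (\<lambda>n. c * (real (\<Psi> n) ^ (k - 1) / q ^ \<Psi> n))"
    by (rule summable_comparison_test[rotated])
      (use lower \<Psi> q \<open>c > 0\<close> in \<open>auto intro!: exI[of _ 0]\<close>)
  thus "summable (\<lambda>n. real (\<Psi> n) ^ (k - 1) / q ^ \<Psi> n)"
    using \<open>c > 0\<close> by (subst (asm) summable_cmult_iff) auto
qed

theorem prob_infinitely_often_heavy: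
  assumes "k \<ge> 1" and "\<And>n. \<Psi> n \<ge> k"
  shows "prob (infinitely_often_heavy k \<Psi>) =
    (if summable (\<lambda>n. real (\<Psi> n) ^ (k - 1) / q ^ \<Psi> n) then 0 else 1)"
proof (cases "summable (\<lambda>n. prob (heavy k (\<Psi> n)))")
  case True
  thus ?thesis
    using prob_infinitely_often_heavy_0[OF True] summable_heavy_iff[OF assms] by simp
next
  case False
  thus ?thesis
    using prob_infinitely_often_heavy_1[OF _ False] summable_heavy_iff[OF assms] \<open>k \<ge> 1\<close> by simp
qed

end

subsection \<open>The Gauss map on balls\<close>

text \<open>Vanishing of all coefficients up to m expresses |x| < q^-m uniformly, including x = 0,
  whose subdegree is the default value 0.\<close>

lemma fls_vanish_iff: "(\<forall>n\<le>m. (x :: 'a::zero fls) $$ n = 0) \<longleftrightarrow> x = 0 \<or> m < fls_subdegree x"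
  by (metis fls_eq0_below_subdegree fls_zero_nth le_less_trans not_le nth_fls_subdegree_nonzero)

text \<open>Multiplicativity of the absolute value in terms of vanishing coefficients.\<close>

lemma fls_vanish_mult_iff:
  fixes x u :: "'a::field fls"
  assumes "u \<noteq> 0"
  shows "(\<forall>n\<le>m + fls_subdegree u. (x * u) $$ n = 0) \<longleftrightarrow> (\<forall>n\<le>m. x $$ n = 0)"
  using assms by (cases "x = 0") (auto simp: fls_vanish_iff)

lemma unit_ideal_iff_subdegree:
  "x \<in> (unit_ideal :: 'a::{field,finite} fls set) \<longleftrightarrow> x = 0 \<or> 0 < fls_subdegree x"
  by (simp add: unit_ideal_iff fls_vanish_iff)

lemma zero_in_unit_ideal: "0 \<in> unit_ideal"
  by (simp add: unit_ideal_iff)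

definition quotient_set :: "'a::{field,finite} poly \<Rightarrow> 'a fls set" where
  "quotient_set P = {x \<in> unit_ideal. int_part (1 / x) = P}"

text \<open>Since 1 / 0 = 0, the value at 0 is 0. At every other point of the unit ideal it is
  positive, so the digit 0 marks exactly an undefined partial quotient.\<close>

definition head_degree :: "'a::{field,finite} fls \<Rightarrow> nat" where
  "head_degree x = degree (int_part (1 / x))"

lemma int_part_add_unit_ideal:
  assumes "y \<in> unit_ideal"
  shows "int_part (poly_to_laurent P + y) = P"
  using assms by (auto intro!: poly_eqI simp: coeff_int_part poly_to_laurent_nth unit_ideal_iff)

lemma int_part_0 [simp]: "int_part 0 = 0"
  by (rule poly_eqI) (simp add: coeff_int_part)

lemma gauss_map_unit_ideal [simp]: "gauss_map x \<in> unit_ideal"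
  by (auto simp: gauss_map_def unit_ideal_iff poly_to_laurent_nth coeff_int_part)

lemma gauss_map_decomp:
  assumes "x \<noteq> 0"
  shows "1 / x = poly_to_laurent (int_part (1 / x)) + gauss_map x"
  using assms by (simp add: gauss_map_def)

lemma subdegree_poly_to_laurent_add:
  assumes "degree P > 0" "y \<in> unit_ideal"
  shows "fls_subdegree (poly_to_laurent P + y) = - int (degree P)"
  using assms
  by (intro fls_subdegree_eqI)
    (auto simp: poly_to_laurent_nth unit_ideal_iff leading_coeff_0_iff coeff_eq_0)

text \<open>For nonzero x in the unit ideal the leading term of 1 / x has positive degree in z and
  so belongs to the integer part. Hence the digit depends on |x| alone.\<close>

lemma head_degree_eq:
  assumes "x \<in> unit_ideal"
  shows "head_degree x = (if x = 0 then 0 else nat (fls_subdegree x))"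
proof (cases "x = 0")
  case False
  define d where "d = nat (fls_subdegree x)"
  have sd: "fls_subdegree (1 / x) = - int d" "1 / x \<noteq> 0"
    using assms False by (auto simp: d_def unit_ideal_iff_subdegree fls_divide_subdegree)
  have "degree (int_part (1 / x)) = d"
  proof (rule antisym)
    show "degree (int_part (1 / x)) \<le> d"
      by (rule degree_le) (auto simp: coeff_int_part sd(1))
    show "d \<le> degree (int_part (1 / x))"
      using nth_fls_subdegree_nonzero[OF sd(2)] by (intro le_degree) (simp add: coeff_int_part sd(1))
  qed
  thus ?thesis using False by (simp add: head_degree_def d_def)
qed (simp add: head_degree_def)

lemma head_degree_pos_iff:
  assumes "x \<in> unit_ideal"
  shows "0 < head_degree x \<longleftrightarrow> x \<noteq> 0"
  using assms by (auto simp: head_degree_eq unit_ideal_iff_subdegree)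

text \<open>The ball |x - a| < q^-m. Within the unit ideal it prescribes m free coefficients, so its
  measure is q^-m.\<close>

definition fls_ball :: "'a::zero fls \<Rightarrow> nat \<Rightarrow> 'a fls set" where
  "fls_ball a m = {x. \<forall>n\<le>int m. x $$ n = a $$ n}"

lemma in_fls_ball_iff: "x \<in> fls_ball (a :: 'a::group_add fls) m \<longleftrightarrow> (\<forall>n\<le>int m. (x - a) $$ n = 0)"
  by (simp add: fls_ball_def)

lemma unit_ideal_eq_ball: "unit_ideal = fls_ball (0 :: 'a::{field,finite} fls) 0"
  by (auto simp: unit_ideal_iff fls_ball_def)

lemma fls_ball_subset_unit_ideal: "a \<in> unit_ideal \<Longrightarrow> fls_ball a m \<subseteq> unit_ideal"
  by (auto simp: unit_ideal_iff fls_ball_def)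

text \<open>The branch \<open>y \<mapsto> 1 / (P + y)\<close> of the inverse of the Gauss map contracts all distances by
  the same factor, as \<open>P + y\<close> has the same absolute value for all \<open>y\<close>.\<close>

lemma quotient_set_gauss_preimage_ball:
  assumes P: "degree P > 0" and a: "a \<in> unit_ideal"
  shows "{x \<in> quotient_set P. gauss_map x \<in> fls_ball a m} =
    fls_ball (1 / (poly_to_laurent P + a)) (m + 2 * degree P)" (is "?L = ?R")
proof (intro equalityI subsetI)
  let ?p = "poly_to_laurent P" and ?d = "int (degree P)"
  have sd: "fls_subdegree (?p + y) = - ?d" "?p + y \<noteq> 0" if "y \<in> unit_ideal" for y
    using subdegree_poly_to_laurent_add[OF P that] P by auto
  {
    fix x assume "x \<in> ?L"
    hence x: "x \<in> unit_ideal" "int_part (1 / x) = P" and Tx: "\<forall>n\<le>int m. (gauss_map x - a) $$ n = 0"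
      by (auto simp: quotient_set_def in_fls_ball_iff)
    have "x \<noteq> 0" using x(2) P by auto
    hence inv: "1 / x = ?p + gauss_map x" using gauss_map_decomp x(2) by metis
    \<comment> \<open>A difference of reciprocals is the difference of the denominators times
      \<open>?u\<close>. Both denominators have absolute value q^(deg P), so \<open>?u\<close> has
      absolute value q^(-2 deg P).\<close>
    let ?u = "- 1 / ((?p + gauss_map x) * (?p + a))"
    have "x = 1 / (?p + gauss_map x)" unfolding inv[symmetric] by simp
    hence "x - 1 / (?p + a) = 1 / (?p + gauss_map x) - 1 / (?p + a)" by simp
    also have "\<dots> = (gauss_map x - a) * ?u"
      using sd(2)[OF a] sd(2)[OF gauss_map_unit_ideal, of x]
      by (simp add: field_simps minus_divide_left del: divide_minus_left)
    finally have eq: "x - 1 / (?p + a) = (gauss_map x - a) * ?u" .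
    have u: "?u \<noteq> 0" "fls_subdegree ?u = 2 * ?d"
      using sd[OF a] sd[OF gauss_map_unit_ideal, of x] by (auto simp: fls_divide_subdegree)
    show "x \<in> ?R"
      unfolding in_fls_ball_iff eq using fls_vanish_mult_iff[OF u(1), of "int m"] Tx
      unfolding u(2) by simp
  next
    fix x assume "x \<in> ?R"
    define w where "w = ?p + a"
    have w: "w \<noteq> 0" "fls_subdegree w = - ?d" using sd[OF a] by (auto simp: w_def)
    have R: "\<forall>n\<le>int m + 2 * ?d. (x - 1 / w) $$ n = 0"
      using \<open>x \<in> ?R\<close> by (simp add: in_fls_ball_iff w_def)
    have iw: "1 / w \<noteq> 0" "fls_subdegree (1 / w) = ?d" using w by (auto simp: fls_divide_subdegree)
    \<comment> \<open>The agreement reaches past index deg P, where 1 / w has its leading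
      coefficient; so x is nonzero with |x| = |1 / w|.\<close>
    have same: "x $$ n = (1 / w) $$ n" if "n \<le> ?d" for n using R that P by auto
    have sx: "fls_subdegree x = ?d"
    proof (rule fls_subdegree_eqI)
      show "x $$ ?d \<noteq> 0" using same[of ?d] nth_fls_subdegree_nonzero[OF iw(1)] iw(2) by simp
      show "x $$ k = 0" if "k < ?d" for k using same[of k] that iw(2) by simp
    qed
    hence "x \<noteq> 0" using P by auto
    have xI: "x \<in> unit_ideal" using sx P by (auto simp: unit_ideal_iff_subdegree)
    let ?u = "- w / x"
    have u: "?u \<noteq> 0" "fls_subdegree ?u = - 2 * ?d"
      using w sx \<open>x \<noteq> 0\<close> by (auto simp: fls_divide_subdegree)
    have "1 / x - w = (x - 1 / w) * ?u" using w(1) \<open>x \<noteq> 0\<close> by (simp add: field_simps)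
    moreover have "\<forall>n\<le>(int m + 2 * ?d) + fls_subdegree ?u. ((x - 1 / w) * ?u) $$ n = 0"
      using fls_vanish_mult_iff[OF u(1)] R by blast
    ultimately have small: "\<forall>n\<le>int m. (1 / x - w) $$ n = 0" unfolding u(2) by simp
    \<comment> \<open>The candidate for \<open>gauss_map x\<close>. Once it is known to lie in the
      unit ideal, the integer part of 1 / x must be P.\<close>
    define y where "y = 1 / x - ?p"
    have y: "y - a = 1 / x - w" by (simp add: y_def w_def)
    have "y \<in> fls_ball a m" unfolding in_fls_ball_iff y by (rule small)
    hence yI: "y \<in> unit_ideal" using fls_ball_subset_unit_ideal[OF a] by blast
    have "1 / x = ?p + y" by (simp add: y_def)
    hence ip: "int_part (1 / x) = P" using int_part_add_unit_ideal[OF yI] by simp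
    hence "gauss_map x = y" using \<open>x \<noteq> 0\<close> by (simp add: gauss_map_def y_def)
    thus "x \<in> ?L" using xI ip \<open>y \<in> fls_ball a m\<close> by (simp add: quotient_set_def)
  }
qed

lemma quotient_set_eq_ball:
  assumes "degree P > 0"
  shows "quotient_set P = fls_ball (1 / poly_to_laurent P) (2 * degree P)"
proof -
  have "quotient_set P = {x \<in> quotient_set P. gauss_map x \<in> fls_ball 0 0}"
    by (simp flip: unit_ideal_eq_ball)
  also have "\<dots> = fls_ball (1 / poly_to_laurent P) (2 * degree P)"
    using quotient_set_gauss_preimage_ball[OF assms, of 0 0] by (simp add: unit_ideal_iff)
  finally show ?thesis .
qed

lemma inverse_add_unit_ideal:
  assumes "degree P > 0" "a \<in> unit_ideal"
  shows "1 / (poly_to_laurent P + a) \<in> unit_ideal"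
proof -
  have "fls_subdegree (poly_to_laurent P + a) < 0"
    using subdegree_poly_to_laurent_add[OF assms] assms(1) by simp
  moreover from this have "poly_to_laurent P + a \<noteq> 0" by (metis fls_zero_subdegree less_irrefl)
  ultimately show ?thesis unfolding unit_ideal_iff_subdegree by (simp add: fls_divide_subdegree)
qed

text \<open>The branches of nonconstant P miss only the point 0; measurability of the Gauss map is
  checked branch by branch.\<close>

lemma gauss_preimage_Union:
  fixes B :: "'a::{field,finite} fls set"
  shows "{x \<in> unit_ideal. gauss_map x \<in> B} =
    (\<Union>P\<in>{P. degree P > 0}. {x \<in> quotient_set P. gauss_map x \<in> B}) \<union> ({0} \<inter> {x. gauss_map x \<in> B})"
proof -
  have "x = 0 \<or> (\<exists>P. 0 < degree P \<and> x \<in> quotient_set P)" if "x \<in> unit_ideal" for x :: "'a fls"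
    using head_degree_pos_iff[OF that] that unfolding head_degree_def quotient_set_def by blast
  moreover have "x \<in> unit_ideal" if "x \<in> quotient_set P" for x and P :: "'a poly"
    using that by (simp add: quotient_set_def)
  ultimately show ?thesis using zero_in_unit_ideal by blast
qed

lemma head_degree_set:
  "d \<ge> 1 \<Longrightarrow> {x \<in> unit_ideal. head_degree x = d} = (fls_ball 0 (d - 1) - fls_ball 0 d :: 'a::{field,finite} fls set)"
proof (intro equalityI subsetI)
  fix x :: "'a fls"
  assume "d \<ge> 1" and "x \<in> {x \<in> unit_ideal. head_degree x = d}"
  thus "x \<in> fls_ball 0 (d - 1) - fls_ball 0 d"
    by (auto simp: head_degree_eq in_fls_ball_iff fls_vanish_iff split: if_splits)
next
  fix x :: "'a fls"
  assume d: "d \<ge> 1" and x: "x \<in> fls_ball 0 (d - 1) - fls_ball 0 d"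
  have "x = 0 \<or> int (d - 1) < fls_subdegree x" "\<not> (x = 0 \<or> int d < fls_subdegree x)"
    using x unfolding Diff_iff in_fls_ball_iff fls_vanish_iff diff_zero by blast+
  hence "x \<noteq> 0" "fls_subdegree x = int d" using d by auto
  thus "x \<in> {x \<in> unit_ideal. head_degree x = d}"
    using d by (auto simp: head_degree_eq unit_ideal_iff_subdegree)
qed

lemma head_degree_0_set: "{x \<in> unit_ideal. head_degree x = 0} = {0}"
  by (auto simp: head_degree_eq unit_ideal_iff_subdegree split: if_splits)

section \<open>Cylinders as generators of the Borel sets of the unit ideal\<close>

definition cylinder :: "'a::{field,finite} list \<Rightarrow> 'a fls set" where
  "cylinder w = {x \<in> unit_ideal. \<forall>i<length w. x $$ (int i + 1) = w ! i}"

lemma fls_ball_eq_cylinder: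
  assumes "a \<in> unit_ideal"
  shows "fls_ball a m = cylinder (map (\<lambda>i. a $$ (int i + 1)) [0..<m])"
proof -
  have "(\<forall>n\<le>int m. x $$ n = a $$ n) \<longleftrightarrow> (\<forall>n\<le>0. x $$ n = a $$ n) \<and> (\<forall>i<m. x $$ (int i + 1) = a $$ (int i + 1))"
    (is "?l \<longleftrightarrow> ?r") for x :: "'a fls"
  proof
    assume r: ?r
    show ?l
    proof (intro allI impI)
      fix n assume "n \<le> int m"
      show "x $$ n = a $$ n"
      proof (cases "n \<le> 0")
        case False
        hence "n = int (nat (n - 1)) + 1" "nat (n - 1) < m" using \<open>n \<le> int m\<close> by auto
        thus ?thesis using r by metis
      qed (use r in auto)
    qed
  qed auto
  thus ?thesis using assms by (auto simp: fls_ball_def cylinder_def unit_ideal_iff)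
qed

lemma cylinder_eq_fls_ball:
  fixes w :: "'a::{field,finite} list"
  obtains a where "a \<in> unit_ideal" "cylinder w = fls_ball a (length w)"
proof
  define a where "a = fls_X * fps_to_fls (Abs_fps (\<lambda>i. if i < length w then w ! i else 0))"
  have nth: "a $$ n = (if n \<le> 0 then 0 else if nat (n - 1) < length w then w ! nat (n - 1) else 0)" for n
    by (simp add: a_def fls_X_times_conv_shift)
  show "a \<in> unit_ideal" by (simp add: unit_ideal_iff nth)
  have "map (\<lambda>i. a $$ (int i + 1)) [0..<length w] = w"
    by (intro nth_equalityI) (auto simp: nth)
  thus "cylinder w = fls_ball a (length w)"
    using fls_ball_eq_cylinder[OF \<open>a \<in> unit_ideal\<close>, of "length w"] by simp
qed

lemma open_fls_ball: "open (fls_ball (a :: 'a::{field,finite} fls) m)"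
  unfolding open_fls_iff_subdegree
proof (intro ballI exI allI impI)
  fix x y assume "x \<in> fls_ball a m" and "y = x \<or> int m < fls_subdegree (y - x)"
  moreover from this(2) have "\<forall>n\<le>int m. (y - x) $$ n = 0"
    by (auto simp only: fls_vanish_iff right_minus_eq)
  ultimately show "y \<in> fls_ball a m" by (auto simp: fls_ball_def)
qed

lemma open_cylinder: "open (cylinder (w :: 'a::{field,finite} list))"
  using open_fls_ball cylinder_eq_fls_ball by metis

text \<open>Ultrametric balls are nested or disjoint. With the empty set added, the cylinders thus
  form a generator closed under intersection, as the Dynkin argument requires.\<close>

lemma cylinder_Int:
  "cylinder v \<inter> cylinder w \<in> {cylinder v, cylinder w, {}}"
proof -
  have *: "cylinder v \<inter> cylinder w \<in> {cylinder w, {}}" if len: "length v \<le> length w" for v w :: "'a::{field,finite} list"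
  proof (cases "\<forall>i<length v. v ! i = w ! i")
    case True
    hence "cylinder v \<inter> cylinder w = cylinder w" using len by (auto simp: cylinder_def)
    thus ?thesis by simp
  next
    case False
    hence "cylinder v \<inter> cylinder w = {}" using len by (auto simp: cylinder_def)
    thus ?thesis by simp
  qed
  show ?thesis using *[of v w] *[of w v] by (cases "length v \<le> length w") (auto simp: Int_commute)
qed

lemma cylinders_subset_Pow: "insert {} (range cylinder) \<subseteq> Pow unit_ideal"
  by (auto simp: cylinder_def)

lemma Int_stable_cylinders: "Int_stable (insert {} (range cylinder))"
  unfolding Int_stable_def
proof (intro ballI)
  fix A B :: "'a fls set"
  assume "A \<in> insert {} (range cylinder)" "B \<in> insert {} (range cylinder)"
  then consider "A = {} \<or> B = {}" | v w where "A = cylinder v" "B = cylinder w" by blast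
  thus "A \<inter> B \<in> insert {} (range cylinder)"
  proof cases
    case (2 v w)
    thus ?thesis using cylinder_Int[of v w] by (metis insertE insertI1 insertI2 rangeI singletonD)
  qed auto
qed

text \<open>An open subset of the unit ideal is the union of the cylinders inside it, and this union
  is countable because cylinders are indexed by words over a finite alphabet.\<close>

lemma sets_restrict_unit_ideal:
  "sets (restrict_space borel (unit_ideal :: 'a::{field,finite} fls set)) =
     sigma_sets unit_ideal (insert {} (range cylinder))"
proof (rule antisym)
  let ?G = "insert {} (range cylinder) :: 'a fls set set"
  let ?M = "restrict_space borel (unit_ideal :: 'a fls set)"
  have I_open: "open (unit_ideal :: 'a fls set)" by (simp add: unit_ideal_eq_ball open_fls_ball)
  have "unit_ideal \<inter> cylinder w \<in> sets ?M" for w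
    unfolding sets_restrict_space by (intro imageI borel_open open_cylinder)
  moreover have "unit_ideal \<inter> cylinder w = cylinder w" for w :: "'a list"
    by (auto simp: cylinder_def)
  ultimately have "cylinder w \<in> sets ?M" for w by simp
  hence "sigma_sets (space ?M) ?G \<subseteq> sets ?M"
    by (intro sets.sigma_sets_subset) auto
  thus "sigma_sets unit_ideal ?G \<subseteq> sets ?M"
    by (simp add: space_restrict_space)
  have "S \<inter> unit_ideal \<in> sigma_sets unit_ideal ?G" if "open S" for S
  proof -
    have "S \<inter> unit_ideal = \<Union> (cylinder ` {w. cylinder w \<subseteq> S})"
    proof (intro equalityI subsetI)
      fix x assume x: "x \<in> S \<inter> unit_ideal"
      with \<open>open S\<close>[unfolded open_fls_iff_subdegree] obtain m :: nat
        where m: "\<And>y. y = x \<or> int m < fls_subdegree (y - x) \<Longrightarrow> y \<in> S"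
        by blast
      have "fls_ball x m \<subseteq> S"
        using m by (auto simp: in_fls_ball_iff fls_vanish_iff simp del: fls_minus_nth)
      moreover have "x \<in> fls_ball x m" by (simp add: fls_ball_def)
      ultimately show "x \<in> \<Union> (cylinder ` {w. cylinder w \<subseteq> S})"
        using fls_ball_eq_cylinder[of x m] x by auto
    qed (auto simp: cylinder_def)
    also have "\<dots> \<in> sigma_sets unit_ideal ?G"
      by (intro sigma_sets_UNION) auto
    finally show ?thesis .
  qed
  hence "sigma_sets unit_ideal ((\<inter>) unit_ideal ` {S. open S}) \<subseteq> sigma_sets unit_ideal ?G"
    by (intro sigma_sets_mono) (auto simp: Int_commute)
  moreover have "sets ?M = sigma_sets unit_ideal ((\<inter>) unit_ideal ` {S. open S})"
    using sigma_sets_Int[of "unit_ideal :: 'a fls set" UNIV "{S. open S}"] I_open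
    by (simp add: sets_restrict_space borel_def sigma_sets.Basic)
  ultimately show "sets ?M \<subseteq> sigma_sets unit_ideal ?G" by simp
qed

lemma countable_UNIV_poly: "countable (UNIV :: 'a::{zero,finite} poly set)"
  by (rule countableI'[of "to_nat \<circ> coeffs"]) (auto intro!: inj_compose simp: inj_def coeffs_eq_iff)

subsection \<open>The Haar measure\<close>

locale haar =
  fixes \<nu> :: "'a::{field,finite} fls measure"
  assumes normalized: "normalized_haar \<nu>"
begin

lemma sets_haar: "sets \<nu> = sigma_sets unit_ideal (insert {} (range cylinder))"
  using normalized by (simp add: normalized_haar_def sets_restrict_unit_ideal)

lemma space_haar [simp]: "space \<nu> = unit_ideal"
  using normalized sets_eq_imp_space_eq[of \<nu> "restrict_space borel unit_ideal"]
  by (simp add: normalized_haar_def space_restrict_space)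

sublocale prob_space \<nu>
  by standard (use normalized in \<open>simp add: normalized_haar_def\<close>)

lemma cylinder_sets [measurable]: "cylinder w \<in> sets \<nu>"
  unfolding sets_haar by (rule sigma_sets.Basic) simp

lemma fls_ball_sets: "a \<in> unit_ideal \<Longrightarrow> fls_ball a m \<in> sets \<nu>"
  by (simp add: fls_ball_eq_cylinder)

lemma prob_translate_eq:
  assumes "a \<in> unit_ideal" "b \<in> unit_ideal"
  shows "prob (fls_ball a m) = prob (fls_ball b m)"
proof -
  have "fls_ball b m = (\<lambda>x. (b - a) + x) ` fls_ball a m"
  proof (intro equalityI subsetI)
    fix x assume "x \<in> fls_ball b m"
    hence "x = (b - a) + (x - b + a)" "x - b + a \<in> fls_ball a m" by (auto simp: fls_ball_def)
    thus "x \<in> (\<lambda>x. (b - a) + x) ` fls_ball a m" by blast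
  qed (auto simp: fls_ball_def)
  moreover have "b - a \<in> unit_ideal" using assms by (auto simp: unit_ideal_iff)
  ultimately show ?thesis
    using normalized fls_ball_sets[OF assms(1)] by (simp add: normalized_haar_def measure_def)
qed

text \<open>The q^m words of length m partition the unit ideal into cylinders that are translates of
  one another.\<close>

lemma prob_fls_ball:
  assumes "a \<in> unit_ideal"
  shows "prob (fls_ball a m) = 1 / real CARD('a) ^ m"
proof -
  let ?L = "{w :: 'a list. length w = m}"
  have "finite ?L" "card ?L = CARD('a) ^ m"
    using finite_lists_length_eq[of "UNIV :: 'a set" m] card_lists_length_eq[of "UNIV :: 'a set" m]
    by auto
  have disj: "disjoint_family_on cylinder ?L"
    unfolding disjoint_family_on_def
  proof (intro ballI impI equals0I)
    fix v w :: "'a list" and x assume vw: "v \<in> ?L" "w \<in> ?L" "v \<noteq> w" and x: "x \<in> cylinder v \<inter> cylinder w"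
    have "v = w"
    proof (rule nth_equalityI)
      show "length v = length w" using vw by simp
      fix i assume "i < length v"
      thus "v ! i = w ! i" using vw x by (simp add: cylinder_def) metis
    qed
    with vw show False by simp
  qed
  have "(unit_ideal :: 'a fls set) = (\<Union>w\<in>?L. cylinder w)"
  proof (intro equalityI subsetI)
    fix x :: "'a fls" assume "x \<in> unit_ideal"
    hence "x \<in> cylinder (map (\<lambda>i. x $$ (int i + 1)) [0..<m])" by (simp add: cylinder_def)
    thus "x \<in> (\<Union>w\<in>?L. cylinder w)" by force
  qed (auto simp: cylinder_def)
  hence "1 = prob (\<Union>w\<in>?L. cylinder w)" using prob_space by simp
  also have "\<dots> = (\<Sum>w\<in>?L. prob (cylinder w))"
    using \<open>finite ?L\<close> disj by (intro finite_measure_finite_Union) auto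
  also have "\<dots> = (\<Sum>w\<in>?L. prob (fls_ball a m))"
  proof (intro sum.cong refl)
    fix w :: "'a list" assume "w \<in> ?L"
    thus "prob (cylinder w) = prob (fls_ball a m)"
      using prob_translate_eq[OF assms] cylinder_eq_fls_ball[of w] by (metis (mono_tags) mem_Collect_eq)
  qed
  finally show ?thesis using \<open>card ?L = _\<close> by (simp add: field_simps)
qed

lemma null_zero: "{0} \<in> null_sets \<nu>"
proof (rule null_setsI)
  have 0: "(0 :: 'a fls) \<in> unit_ideal" by (simp add: unit_ideal_iff)
  have eq: "{0 :: 'a fls} = (\<Inter>m. fls_ball 0 m)"
  proof (intro equalityI subsetI)
    fix x :: "'a fls" assume x: "x \<in> (\<Inter>m. fls_ball 0 m)"
    have "x $$ n = 0" for n
      using x by (auto simp: fls_ball_def dest!: spec[of _ "nat n"])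
    thus "x \<in> {0}" by (auto intro: fls_eqI)
  qed (auto simp: fls_ball_def)
  show *: "{0} \<in> sets \<nu>" unfolding eq using fls_ball_sets[OF 0] by (intro sets.countable_INT) auto
  have "prob {0} \<le> (1 / real CARD('a)) ^ m" for m
    using finite_measure_mono[of "{0}" "fls_ball 0 m"] fls_ball_sets[OF 0] prob_fls_ball[OF 0, of m]
    by (auto simp: fls_ball_def power_divide)
  moreover have "(\<lambda>m. (1 / real CARD('a)) ^ m) \<longlonglongrightarrow> 0"
    using one_less_CARD_field[where 'a='a] by (intro LIMSEQ_realpow_zero) auto
  ultimately have "prob {0} \<le> 0" by (intro LIMSEQ_le_const) auto
  thus "emeasure \<nu> {0} = 0" by (simp add: emeasure_eq_measure measure_le_0_iff)
qed

text \<open>The set is a ball of measure q^-(m + 2 deg P), and the factor q^(-2 deg P) is the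
  measure of the branch itself.\<close>

lemma prob_quotient_set_ball:
  assumes "degree P > 0" "a \<in> unit_ideal"
  shows "{x \<in> quotient_set P. gauss_map x \<in> fls_ball a m} \<in> sets \<nu>"
    and "prob {x \<in> quotient_set P. gauss_map x \<in> fls_ball a m} = prob (quotient_set P) * prob (fls_ball a m)"
proof -
  note ball = quotient_set_gauss_preimage_ball[OF assms] and I = inverse_add_unit_ideal[OF assms]
  show "{x \<in> quotient_set P. gauss_map x \<in> fls_ball a m} \<in> sets \<nu>"
    unfolding ball by (rule fls_ball_sets[OF I])
  have "prob (quotient_set P) = 1 / real CARD('a) ^ (2 * degree P)"
    using inverse_add_unit_ideal[OF assms(1), of 0]
    by (simp add: quotient_set_eq_ball assms(1) prob_fls_ball zero_in_unit_ideal)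
  thus "prob {x \<in> quotient_set P. gauss_map x \<in> fls_ball a m} = prob (quotient_set P) * prob (fls_ball a m)"
    unfolding ball using assms by (simp add: prob_fls_ball I power_add)
qed

lemma quotient_set_sets:
  assumes "degree P > 0"
  shows "quotient_set P \<in> sets \<nu>"
proof -
  have "1 / poly_to_laurent P \<in> (unit_ideal :: 'a fls set)"
    using inverse_add_unit_ideal[OF assms zero_in_unit_ideal] by simp
  thus ?thesis unfolding quotient_set_eq_ball[OF assms] by (rule fls_ball_sets)
qed

lemma gauss_map_measurable: "gauss_map \<in> measurable \<nu> \<nu>"
proof (rule measurable_sigma_sets)
  show "sets \<nu> = sigma_sets unit_ideal (insert {} (range cylinder))" by (rule sets_haar)
  show "insert {} (range cylinder) \<subseteq> Pow (unit_ideal :: 'a fls set)" by (rule cylinders_subset_Pow)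
  fix B :: "'a fls set" assume B: "B \<in> insert {} (range cylinder)"
  have "{x \<in> unit_ideal. gauss_map x \<in> B} \<in> sets \<nu>"
  proof (cases "B = {}")
    case False
    then obtain a m where a: "a \<in> unit_ideal" "B = fls_ball a m"
      using B cylinder_eq_fls_ball by (metis imageE insert_iff)
    have "{0} \<inter> {x. gauss_map x \<in> B} \<in> sets \<nu>"
      using null_zero by (cases "gauss_map 0 \<in> B") (auto simp: Int_insert_left)
    thus ?thesis unfolding gauss_preimage_Union
      using prob_quotient_set_ball(1)[OF _ a(1)] countable_subset[OF subset_UNIV countable_UNIV_poly]
      unfolding a(2) by (intro sets.Un sets.countable_UN') auto
  qed simp
  thus "gauss_map -` B \<inter> space \<nu> \<in> sets \<nu>"
    by (simp add: vimage_def Int_def conj_commute)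
qed simp

lemma quotient_set_Int_sets:
  assumes "degree P > 0" "B \<in> sets \<nu>"
  shows "{x \<in> quotient_set P. gauss_map x \<in> B} \<in> sets \<nu>"
proof -
  have "{x \<in> quotient_set P. gauss_map x \<in> B} = quotient_set P \<inter> (gauss_map -` B \<inter> space \<nu>)"
    by (auto simp: quotient_set_def)
  thus ?thesis
    using quotient_set_sets[OF assms(1)] measurable_sets[OF gauss_map_measurable assms(2)] by simp
qed

text \<open>On the branch of P the image \<open>gauss_map x\<close> is Haar distributed. Known for
  balls, this passes to complements and countable disjoint unions, hence to all Borel sets.\<close>

lemma prob_quotient_set:
  assumes P: "degree P > 0" and B: "B \<in> sets \<nu>"
  shows "prob {x \<in> quotient_set P. gauss_map x \<in> B} = prob (quotient_set P) * prob B"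
  using Int_stable_cylinders cylinders_subset_Pow B[unfolded sets_haar]
proof (induction rule: sigma_sets_induct_disjoint)
  case (basic A)
  then obtain a m where "A = {} \<or> a \<in> unit_ideal \<and> A = fls_ball a m"
    using cylinder_eq_fls_ball by (metis imageE insert_iff)
  thus ?case using prob_quotient_set_ball(2)[OF P] by auto
next
  case (compl A)
  hence A: "A \<in> sets \<nu>" by (simp add: sets_haar)
  have "{x \<in> quotient_set P. gauss_map x \<in> unit_ideal - A} =
      quotient_set P - {x \<in> quotient_set P. gauss_map x \<in> A}" by auto
  hence "prob {x \<in> quotient_set P. gauss_map x \<in> unit_ideal - A} =
      prob (quotient_set P) - prob {x \<in> quotient_set P. gauss_map x \<in> A}"
    using quotient_set_Int_sets[OF P A] quotient_set_sets[OF P] by (simp add: finite_measure_Diff)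
  moreover have "prob (unit_ideal - A) = 1 - prob A"
    using prob_compl[OF A] by simp
  ultimately show ?case using compl by (simp add: right_diff_distrib)
next
  case (union A)
  have A: "A i \<in> sets \<nu>" for i using union(2) unfolding sets_haar by blast
  have "(\<lambda>i. prob {x \<in> quotient_set P. gauss_map x \<in> A i}) sums
      prob (\<Union>i. {x \<in> quotient_set P. gauss_map x \<in> A i})"
    using quotient_set_Int_sets[OF P A] union(1)
    by (intro finite_measure_UNION) (auto simp: disjoint_family_on_def)
  moreover have "(\<Union>i. {x \<in> quotient_set P. gauss_map x \<in> A i}) = {x \<in> quotient_set P. gauss_map x \<in> (\<Union>i. A i)}"
    by auto
  moreover have "(\<lambda>i. prob (quotient_set P) * prob (A i)) sums (prob (quotient_set P) * prob (\<Union>i. A i))"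
    using A union(1) by (intro sums_mult finite_measure_UNION) auto
  ultimately show ?case using union by (simp add: sums_unique2)
qed simp

lemma head_degree_set_sets: "{x \<in> unit_ideal. head_degree x = d} \<in> sets \<nu>"
proof (cases "d = 0")
  case True
  thus ?thesis using null_zero by (auto simp: head_degree_0_set)
next
  case False
  thus ?thesis
    using fls_ball_sets[OF zero_in_unit_ideal] by (simp add: head_degree_set sets.Diff)
qed

text \<open>The event is the sphere |x| = q^-d, a difference of concentric balls of measures
  q^-(d-1) and q^-d.\<close>

lemma prob_head_degree:
  assumes "d \<ge> 1"
  shows "prob {x \<in> unit_ideal. head_degree x = d} = (real CARD('a) - 1) / real CARD('a) ^ d"
proof -
  have "prob (fls_ball 0 (d - 1) - fls_ball 0 d :: 'a fls set) = prob (fls_ball 0 (d - 1)) - prob (fls_ball 0 d)"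
    using assms by (intro finite_measure_Diff fls_ball_sets[OF zero_in_unit_ideal]) (auto simp: fls_ball_def)
  thus ?thesis
    using assms unfolding head_degree_set[OF assms] prob_fls_ball[OF zero_in_unit_ideal]
    by (cases d) (auto simp: field_simps)
qed

lemma prob_head_degree_gauss_map:
  assumes B: "B \<in> sets \<nu>"
  shows "prob {x \<in> unit_ideal. head_degree x = d \<and> gauss_map x \<in> B} =
    prob {x \<in> unit_ideal. head_degree x = d} * prob B"
proof (cases "d = 0")
  case True
  have "{x \<in> unit_ideal. head_degree x = d \<and> gauss_map x \<in> B} \<subseteq> {0}"
    using True head_degree_0_set by blast
  hence "prob {x \<in> unit_ideal. head_degree x = d \<and> gauss_map x \<in> B} \<le> prob {0}"
    using null_zero by (intro finite_measure_mono) auto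
  also have "prob {0} = 0" using null_zero by (simp add: measure_eq_0_null_sets)
  finally show ?thesis
    using True \<open>prob {0} = 0\<close> by (simp add: head_degree_0_set measure_le_0_iff)
next
  case False
  let ?Q = "{P :: 'a poly. degree P = d}"
  have eq: "{x \<in> unit_ideal. head_degree x = d \<and> gauss_map x \<in> B} =
      (\<Union>P\<in>?Q. {x \<in> quotient_set P. gauss_map x \<in> B})" for B
    by (auto simp: quotient_set_def head_degree_def)
  have em: "emeasure \<nu> (\<Union>P\<in>?Q. {x \<in> quotient_set P. gauss_map x \<in> B}) =
      (\<integral>\<^sup>+P. emeasure \<nu> (quotient_set P) * emeasure \<nu> B \<partial>count_space ?Q)"
    if "B \<in> sets \<nu>" for B
  proof -
    have "emeasure \<nu> (\<Union>P\<in>?Q. {x \<in> quotient_set P. gauss_map x \<in> B}) =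
        (\<integral>\<^sup>+P. emeasure \<nu> {x \<in> quotient_set P. gauss_map x \<in> B} \<partial>count_space ?Q)"
      using quotient_set_Int_sets[OF _ that] False countable_subset[OF subset_UNIV countable_UNIV_poly]
      by (intro emeasure_UN_countable) (auto simp: disjoint_family_on_def quotient_set_def)
    also have "\<dots> = (\<integral>\<^sup>+P. emeasure \<nu> (quotient_set P) * emeasure \<nu> B \<partial>count_space ?Q)"
      using False by (intro nn_integral_cong)
        (auto simp: emeasure_eq_measure prob_quotient_set[OF _ that] ennreal_mult)
    finally show ?thesis .
  qed
  \<comment> \<open>Taking the whole unit ideal for B evaluates the sum over P as the measure of the
    digit event, since every value of the Gauss map lies there.\<close>
  have "emeasure \<nu> (unit_ideal :: 'a fls set) = 1" using emeasure_space_1 by simp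
  moreover have "(unit_ideal :: 'a fls set) \<in> sets \<nu>" using sets.top[of \<nu>] by simp
  ultimately have "emeasure \<nu> {x \<in> unit_ideal. head_degree x = d} =
      (\<integral>\<^sup>+P. emeasure \<nu> (quotient_set P) \<partial>count_space ?Q)"
    using em[of unit_ideal] eq[of unit_ideal] by simp
  moreover have "emeasure \<nu> {x \<in> unit_ideal. head_degree x = d \<and> gauss_map x \<in> B} =
      (\<integral>\<^sup>+P. emeasure \<nu> (quotient_set P) \<partial>count_space ?Q) * emeasure \<nu> B"
    unfolding eq em[OF B] by (rule nn_integral_multc) simp
  ultimately show ?thesis by (simp add: measure_def enn2real_mult)
qed

lemma geometric_process: "geometric_process \<nu> gauss_map head_degree (real CARD('a))"
proof unfold_locales
  show "head_degree \<in> measurable \<nu> (count_space UNIV)"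
    using head_degree_set_sets by (subst measurable_count_space_eq2_countable) (auto simp: vimage_def Int_def conj_commute)
  show "1 < real CARD('a)" by (rule one_less_CARD_field)
qed (simp_all add: gauss_map_measurable prob_head_degree_gauss_map prob_head_degree)

end

section \<open>Rounding real thresholds, and the theorem\<close>

lemma summable_nat_ceiling_iff:
  fixes \<Phi> :: "nat \<Rightarrow> real" and q :: real
  assumes q: "1 < q" and \<Phi>: "\<And>n. 1 \<le> \<Phi> n"
  shows "summable (\<lambda>n. real (nat \<lceil>\<Phi> n\<rceil>) ^ j / q ^ nat \<lceil>\<Phi> n\<rceil>) \<longleftrightarrow> summable (\<lambda>n. \<Phi> n ^ j / q powr \<Phi> n)"
    (is "summable ?f \<longleftrightarrow> summable ?g")
proof
  define m where "m n = real (nat \<lceil>\<Phi> n\<rceil>)" for n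
  \<comment> \<open>Rounding up multiplies q^\<Phi> by at most q and, as \<Phi> n >= 1, multiplies
    \<Phi> by at most 2. This yields the constants q and 2^j.\<close>
  have m: "\<Phi> n \<le> m n" "m n \<le> \<Phi> n + 1" "m n \<le> 2 * \<Phi> n" for n
    using \<Phi>[of n] by (auto simp: m_def) linarith+
  have f: "?f n = m n ^ j / q powr m n" for n
    using q by (simp add: m_def powr_realpow)
  have g_le: "norm (?g n) \<le> q * ?f n" for n
  proof -
    have "q powr m n \<le> q powr (\<Phi> n + 1)" using q m[of n] by (intro powr_mono) auto
    hence "1 / q powr \<Phi> n \<le> q / q powr m n" using q by (simp add: powr_add field_simps)
    hence "\<Phi> n ^ j * (1 / q powr \<Phi> n) \<le> m n ^ j * (q / q powr m n)"
      using q m[of n] \<Phi>[of n] by (intro mult_mono power_mono) auto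
    thus ?thesis using \<Phi>[of n] q unfolding f by (simp add: mult.commute)
  qed
  have f_le: "norm (?f n) \<le> 2 ^ j * ?g n" for n
  proof -
    have "m n ^ j \<le> (2 * \<Phi> n) ^ j" using m[of n] \<Phi>[of n] by (intro power_mono) auto
    moreover have "q powr \<Phi> n \<le> q powr m n" using q m[of n] by (intro powr_mono) auto
    ultimately have "m n ^ j / q powr m n \<le> (2 * \<Phi> n) ^ j / q powr \<Phi> n"
      using q \<Phi>[of n] by (intro frac_le) auto
    moreover have "0 \<le> m n" using m(1)[of n] \<Phi>[of n] by linarith
    ultimately show ?thesis using q unfolding f by (simp add: power_mult_distrib)
  qed
  show "summable ?g" if "summable ?f"
    using summable_mult[OF that, of q] g_le by (rule summable_comparison_test'[where N = 0])
  show "summable ?f" if "summable ?g"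
    using summable_mult[OF that, of "2 ^ j"] f_le by (rule summable_comparison_test'[where N = 0])
qed

theorem theorem1p1:
  fixes \<nu> :: "'a::{field,finite} fls measure"
    and k :: nat and \<Phi> :: "nat \<Rightarrow> real"
  assumes haar: "normalized_haar \<nu>"
    and k: "k \<ge> 1"
    and \<Phi>: "\<And>n. n \<ge> 1 \<Longrightarrow> \<Phi> n \<ge> real k"
  shows "F_set k \<Phi> \<in> sets \<nu> \<and>
    emeasure \<nu> (F_set k \<Phi>) =
      (if summable (\<lambda>n. \<Phi> (Suc n) ^ (k - 1) / real CARD('a) powr \<Phi> (Suc n)) then 0 else 1)"
proof -
  interpret haar \<nu> by standard (rule haar)
  interpret geometric_process \<nu> gauss_map head_degree "real CARD('a)"
    by (rule geometric_process)
  \<comment> \<open>Sums of degrees are integers, so they reach \<Phi> exactly when they reach its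
    ceiling. The index is shifted because \<open>heavy\<close> events are counted from n =
    0.\<close>
  define \<Psi> where "\<Psi> n = nat \<lceil>\<Phi> (Suc n)\<rceil>" for n
  have \<Psi>: "\<Psi> n \<ge> k" for n using \<Phi>[of "Suc n"] by (simp add: \<Psi>_def le_nat_iff) linarith
  have orbit: "(gauss_map ^^ n) x \<in> unit_ideal" if "x \<in> unit_ideal" for n and x :: "'a fls"
    using that by (cases n) auto
  have heavy_iff: "(\<forall>i\<in>{1..k}. partial_quotient_defined x (Suc n + i)) \<and>
      real (\<Sum>i=1..k. degree (partial_quotient x (Suc n + i))) \<ge> \<Phi> (Suc n) \<longleftrightarrow>
      (gauss_map ^^ n) (gauss_map x) \<in> heavy k (\<Psi> n)" if x: "x \<in> unit_ideal" for x :: "'a fls" and n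
  proof -
    have shift: "(gauss_map ^^ (i - 1)) ((gauss_map ^^ n) (gauss_map x)) = (gauss_map ^^ (Suc n + i - 1)) x"
      if "i \<in> {1..k}" for i
    proof -
      have "Suc n + i - 1 = (i - 1) + Suc n" using that by auto
      thus ?thesis by (simp only: funpow_add funpow_Suc_right o_def)
    qed
    have pq: "degree (partial_quotient x (Suc n + i)) = head_degree ((gauss_map ^^ (i - 1)) ((gauss_map ^^ n) (gauss_map x)))"
      "partial_quotient_defined x (Suc n + i) \<longleftrightarrow> 0 < head_degree ((gauss_map ^^ (i - 1)) ((gauss_map ^^ n) (gauss_map x)))"
      if "i \<in> {1..k}" for i
      unfolding shift[OF that] partial_quotient_def partial_quotient_defined_def
        head_degree_pos_iff[OF orbit[OF x]] by (simp_all add: head_degree_def)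
    have le: "\<Phi> (Suc n) \<le> real s \<longleftrightarrow> \<Psi> n \<le> s" for s
      by (simp add: \<Psi>_def nat_le_iff ceiling_le_iff)
    have "(\<forall>i\<in>{1..k}. partial_quotient_defined x (Suc n + i)) \<longleftrightarrow>
        (\<forall>i\<in>{1..k}. 0 < head_degree ((gauss_map ^^ (i - 1)) ((gauss_map ^^ n) (gauss_map x))))"
      by (intro ball_cong refl pq)
    moreover have "(\<Sum>i=1..k. degree (partial_quotient x (Suc n + i))) =
        (\<Sum>i=1..k. head_degree ((gauss_map ^^ (i - 1)) ((gauss_map ^^ n) (gauss_map x))))"
      by (intro sum.cong refl pq)
    ultimately show ?thesis
      unfolding le in_heavy_iff by (simp only: space_haar orbit[OF gauss_map_unit_ideal] simp_thms)
  qed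
  \<comment> \<open>For n >= 1 the partial quotients involved start at A_2, the first digit of
    \<open>gauss_map x\<close>; invariance then removes this one application of the map.\<close>
  have F: "F_set k \<Phi> = {x \<in> space \<nu>. gauss_map x \<in> infinitely_often_heavy k \<Psi>}"
  proof -
    have "{n. n \<ge> 1 \<and> P n} = Suc ` {n. P (Suc n)}" for P
      by (auto simp: image_iff) (metis Suc_le_D)
    hence "infinite {n. n \<ge> 1 \<and> P n} \<longleftrightarrow> infinite {n. P (Suc n)}" for P
      by (simp add: finite_image_iff)
    thus ?thesis
      unfolding F_set_def infinitely_often_heavy_def mem_Collect_eq space_haar
      by (intro Collect_cong conj_cong refl) (simp only: heavy_iff gauss_map_unit_ideal simp_thms)
  qed
  have "prob (F_set k \<Phi>) = (if summable (\<lambda>n. real (\<Psi> n) ^ (k - 1) / real CARD('a) ^ \<Psi> n) then 0 else 1)"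
    unfolding F prob_shift[OF infinitely_often_heavy_sets] by (rule prob_infinitely_often_heavy[OF k \<Psi>])
  moreover have "1 \<le> \<Phi> (Suc n)" for n using \<Phi>[of "Suc n"] k by simp
  hence "summable (\<lambda>n. real (\<Psi> n) ^ (k - 1) / real CARD('a) ^ \<Psi> n) \<longleftrightarrow>
      summable (\<lambda>n. \<Phi> (Suc n) ^ (k - 1) / real CARD('a) powr \<Phi> (Suc n))"
    unfolding \<Psi>_def by (intro summable_nat_ceiling_iff one_less_CARD_field)
  moreover have "F_set k \<Phi> \<in> sets \<nu>" unfolding F by measurable
  ultimately show ?thesis by (simp add: emeasure_eq_measure)
qed

end
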